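(* Let $a,b\in\mathbb{Z}$ be such that $F(x)=x^9+ax+b$ is irreducible over $\mathbb{Q}$, and assume that for every rational prime $p$ one has $\nu_p(a)\leq 7$ or $\nu_p(b)\leq 8$. Let $\alpha$ be a complex root of $F(x)$, $K=\mathbb{Q}(\alpha)$, and $\mathbb{Z}_K$ its ring of integers. Then the ring $\mathbb{Z}[\alpha]$ is integrally closed if and only if all of the following conditions hold: (1) If a rational prime $p$ divides both $a$ and $b$, then $\nu_p(b)=1$. (2) If $2$ does not divide $a$ and $2$ divides $b$, then $(a,b)\equiv(1,0)\pmod 4$ or $(a,b)\equiv(3,2)\pmod 4$. (3) If $3$ divides $a$ and $3$ does not divide $b$, then $(a,b)\bmod 9$ belongs to $\{(0,2),(0,5),(3,-1),(3,2),(6,-1),(6,5),(0,4),(0,7),(3,1),(3,7),(6,1),(6,4)\}$. (4) For every rational prime $p\notin\{2,3\}$ dividing $2^{24}a^9+3^{18}b^8$, if $\nu_p(ab)=0$, then $\nu_p(2^{24}a^9+3^{18}b^8)=1$. Moreover, if all these conditions hold, then $K$ is monogenic and $i(K)=1$.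
   Context: $\nu_p$ denotes the $p$-adic valuation on $\mathbb{Q}$. The index $i(K)$ of a number field $K$ is $\gcd\{(\mathbb{Z}_K:\mathbb{Z}[\theta]) : \theta\in\mathbb{Z}_K,\ K=\mathbb{Q}(\theta)\}$. $K$ is monogenic if $\mathbb{Z}_K=\mathbb{Z}[\theta]$ for some $\theta\in\mathbb{Z}_K$. Note $2^{24}a^9+3^{18}b^8$ is the discriminant of $F(x)$. *)

theory Defs
  imports
    "HOL-Computational_Algebra.Computational_Algebra"
    "HOL-Number_Theory.Cong"
    "HOL-Library.Extended_Real"
begin

text \<open>The library's \<open>multiplicity\<close> sends 0 to 0; the valuation must send 0 to \<open>\<infinity>\<close>, which
  matters below since \<open>a = 0\<close> is not excluded.\<close>

definition padic_val :: "int \<Rightarrow> rat \<Rightarrow> ereal" where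
  "padic_val p x =
     (if x = 0 then \<infinity>
      else ereal (real (multiplicity p (fst (quotient_of x))) -
                  real (multiplicity p (snd (quotient_of x)))))"

lemma padic_val_0: "padic_val p 0 = \<infinity>"
  by (simp add: padic_val_def)

lemma padic_val_of_int:
  "n \<noteq> 0 \<Longrightarrow> padic_val p (of_int n) = ereal (real (multiplicity p n))"
  by (simp add: padic_val_def)


text \<open>Number fields and their subrings are represented as subsets of the complex numbers.\<close>

definition subfield_set :: "'a::field set \<Rightarrow> bool" where
  "subfield_set K \<longleftrightarrow>
     0 \<in> K \<and> 1 \<in> K \<and>
     (\<forall>x\<in>K. \<forall>y\<in>K. x + y \<in> K \<and> x * y \<in> K) \<and>
     (\<forall>x\<in>K. - x \<in> K \<and> inverse x \<in> K)"

text \<open>\<open>\<rat>(\<theta>)\<close>: every subfield of \<open>\<complex>\<close> contains \<open>\<rat>\<close>, so this is the subfield generated by \<open>\<theta>\<close>.\<close>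

definition rat_adjoin :: "complex \<Rightarrow> complex set" where
  "rat_adjoin \<theta> = subfield_set hull {\<theta>}"

definition int_adjoin :: "complex \<Rightarrow> complex set" where
  "int_adjoin \<theta> = range (\<lambda>p :: int poly. poly (map_poly of_int p) \<theta>)"

definition ring_of_integers :: "complex set \<Rightarrow> complex set" where
  "ring_of_integers K = {x \<in> K. algebraic_int x}"

definition is_integral_over :: "'a::field set \<Rightarrow> 'a \<Rightarrow> bool" where
  "is_integral_over R x \<longleftrightarrow>
     (\<exists>p. lead_coeff p = 1 \<and> (\<forall>i. coeff p i \<in> R) \<and> poly p x = 0)"

definition fraction_field_of :: "'a::field set \<Rightarrow> 'a set" where
  "fraction_field_of R = {x / y | x y. x \<in> R \<and> y \<in> R \<and> y \<noteq> 0}"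

definition integrally_closed_ring :: "'a::field set \<Rightarrow> bool" where
  "integrally_closed_ring R \<longleftrightarrow>
     (\<forall>x \<in> fraction_field_of R. is_integral_over R x \<longrightarrow> x \<in> R)"

definition additive_index :: "'a::ab_group_add set \<Rightarrow> 'a set \<Rightarrow> nat" where
  "additive_index R S = card (R // {(x, y). x \<in> R \<and> y \<in> R \<and> x - y \<in> S})"

definition field_index :: "complex set \<Rightarrow> nat" where
  "field_index K =
     Gcd {additive_index (ring_of_integers K) (int_adjoin \<theta>) | \<theta>.
            \<theta> \<in> ring_of_integers K \<and> K = rat_adjoin \<theta>}"

definition monogenic_field :: "complex set \<Rightarrow> bool" where
  "monogenic_field K \<longleftrightarrow> (\<exists>\<theta> \<in> ring_of_integers K. ring_of_integers K = int_adjoin \<theta>)"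


definition trinomial9 :: "int \<Rightarrow> int \<Rightarrow> int poly" where
  "trinomial9 a b = monom 1 9 + monom a 1 + monom b 0"

definition disc9 :: "int \<Rightarrow> int \<Rightarrow> int" where
  "disc9 a b = 2 ^ 24 * a ^ 9 + 3 ^ 18 * b ^ 8"

definition cond_common_primes :: "int \<Rightarrow> int \<Rightarrow> bool" where
  "cond_common_primes a b \<longleftrightarrow>
     (\<forall>p :: int. prime p \<and> p dvd a \<and> p dvd b \<longrightarrow> padic_val p (of_int b) = 1)"

definition cond_at_2 :: "int \<Rightarrow> int \<Rightarrow> bool" where
  "cond_at_2 a b \<longleftrightarrow>
     (\<not> 2 dvd a \<and> 2 dvd b \<longrightarrow>
        ([a = 1] (mod 4) \<and> [b = 0] (mod 4)) \<or> ([a = 3] (mod 4) \<and> [b = 2] (mod 4)))"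

definition cond_at_3 :: "int \<Rightarrow> int \<Rightarrow> bool" where
  "cond_at_3 a b \<longleftrightarrow>
     (3 dvd a \<and> \<not> 3 dvd b \<longrightarrow>
        (\<exists>(r, s) \<in> {(0, 2), (0, 5), (3, -1), (3, 2), (6, -1), (6, 5),
                     (0, 4), (0, 7), (3, 1), (3, 7), (6, 1), (6, 4)}.
           [a = r] (mod 9) \<and> [b = s] (mod 9)))"

definition cond_disc :: "int \<Rightarrow> int \<Rightarrow> bool" where
  "cond_disc a b \<longleftrightarrow>
     (\<forall>p :: int. prime p \<and> p \<notin> {2, 3} \<and> p dvd disc9 a b \<longrightarrow>
        padic_val p (of_int (a * b)) = 0 \<longrightarrow> padic_val p (of_int (disc9 a b)) = 1)"

end

theory Submission
  imports
    Defs
    "HOL-Computational_Algebra.Field_as_Ring"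
    "Jordan_Normal_Form.Char_Poly"
begin

hide_const (open) Module.smult

text \<open>
  Both sides are equivalent to the absence of a \<^emph>\<open>singular point\<close>, i.e. a prime \<open>p\<close> and an integer
  \<open>r\<close> with \<open>p\<^sup>2 dvd F(r)\<close> and \<open>p dvd F'(r)\<close>.

  At a singular point, \<open>S(\<alpha>) / p\<close> with \<open>S = (F - F(r)) / (x - r)\<close> is integral but not in \<open>\<int>[\<alpha>]\<close>.
  Conversely, among the integral elements \<open>z\<close> outside \<open>\<int>[\<alpha>]\<close> with \<open>p z\<close> in \<open>\<int>[\<alpha>]\<close> for some prime \<open>p\<close>,
  choose one whose conductor \<open>{h. h(\<alpha>) z \<in> \<int>[\<alpha>]}\<close> is as large as possible. It is a prime ideal of
  \<open>\<int>[x]\<close> containing \<open>p\<close>, \<open>F\<close> and \<open>F'\<close>. For \<open>F = x\<^sup>9 + a x + b\<close> such an ideal contains some \<open>x - r\<close>, and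
  then \<open>p\<^sup>2 dvd F(r)\<close>, since otherwise \<open>\<int>[\<alpha>]\<close> is regular at \<open>(p, \<alpha> - r)\<close>.

  The singular points are found by elementary congruences: \<open>r = 0\<close> if \<open>p\<close> divides \<open>a\<close> and \<open>b\<close>,
  \<open>r \<equiv> - 1\<close> for \<open>p = 2\<close>, \<open>r \<equiv> - b\<close> for \<open>p = 3\<close>, and \<open>r \<equiv> - 9 b / (8 a)\<close> for the other primes, where
  \<open>(8 a)\<^sup>9 F(r) \<equiv> - b (2\<^sup>2\<^sup>4 a\<^sup>9 + 3\<^sup>1\<^sup>8 b\<^sup>8)\<close>.
\<close>

section \<open>Integrality over subrings\<close>

abbreviation int_eval :: "complex \<Rightarrow> int poly \<Rightarrow> complex" where
  "int_eval \<theta> h \<equiv> poly (map_poly of_int h) \<theta>"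

text \<open>Closure under differences carries zero, negatives and sums with it, so fewer closure
  facts have to be checked.\<close>

definition subring_set :: "'a::comm_ring_1 set \<Rightarrow> bool" where
  "subring_set R \<longleftrightarrow> 1 \<in> R \<and> (\<forall>x\<in>R. \<forall>y\<in>R. x - y \<in> R \<and> x * y \<in> R)"

lemma subring_setD:
  assumes "subring_set R"
  shows "0 \<in> R" "1 \<in> R" "x \<in> R \<Longrightarrow> y \<in> R \<Longrightarrow> x - y \<in> R" "x \<in> R \<Longrightarrow> - x \<in> R"
    "x \<in> R \<Longrightarrow> y \<in> R \<Longrightarrow> x + y \<in> R" "x \<in> R \<Longrightarrow> y \<in> R \<Longrightarrow> x * y \<in> R"
proof -
  show 1: "1 \<in> R" and d: "\<And>x y. x \<in> R \<Longrightarrow> y \<in> R \<Longrightarrow> x - y \<in> R"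
    and m: "\<And>x y. x \<in> R \<Longrightarrow> y \<in> R \<Longrightarrow> x * y \<in> R"
    using assms by (auto simp: subring_set_def)
  show z: "0 \<in> R" using d[OF 1 1] by simp
  show n: "- x \<in> R" if "x \<in> R" for x using d[OF z that] by simp
  show "x + y \<in> R" if "x \<in> R" "y \<in> R" using d[OF that(1) n[OF that(2)]] by simp
qed

lemma subring_set_power: "subring_set R \<Longrightarrow> x \<in> R \<Longrightarrow> x ^ n \<in> R"
  by (induction n) (auto intro: subring_setD)

lemma subring_set_sum: "subring_set R \<Longrightarrow> (\<And>i. i \<in> S \<Longrightarrow> f i \<in> R) \<Longrightarrow> sum f S \<in> R"
  by (induction S rule: infinite_finite_induct) (auto intro: subring_setD)

text \<open>Giving the \<open>i\<close>-th coefficient of \<open>p\<close> the weight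
  \<open>u ^ (n - i)\<close> keeps it monic and multiplies its root by \<open>u\<close>. Scaling by
  ring elements is the only operation on integral elements used below.\<close>

lemma is_integral_over_mult:
  fixes y :: "'a::field"
  assumes R: "subring_set R" and y: "is_integral_over R y" and u: "u \<in> R"
  shows "is_integral_over R (u * y)"
proof -
  obtain p where p: "lead_coeff p = 1" "\<And>i. coeff p i \<in> R" "poly p y = 0"
    using y by (auto simp: is_integral_over_def)
  define n where "n = degree p"
  define q where "q = (\<Sum>i\<le>n. monom (u ^ (n - i) * coeff p i) i)"
  have c: "coeff q i = (if i \<le> n then u ^ (n - i) * coeff p i else 0)" for i
    by (simp add: q_def coeff_sum if_distrib cong: if_cong)
  have "degree q \<le> n" by (rule degree_le) (simp add: c)
  moreover have qn: "coeff q n = 1" using p by (simp add: c n_def)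
  hence "n \<le> degree q" by (intro le_degree) simp
  ultimately have "lead_coeff q = 1" using qn by simp
  moreover have "coeff q i \<in> R" for i
    using p(2) u by (auto simp: c intro!: subring_setD[OF R] subring_set_power[OF R])
  moreover have "poly q (u * y) = 0"
  proof -
    have "poly q (u * y) = (\<Sum>i\<le>n. u ^ (n - i) * coeff p i * (u * y) ^ i)"
      by (simp add: q_def poly_sum poly_monom)
    also have "\<dots> = (\<Sum>i\<le>n. u ^ n * (coeff p i * y ^ i))"
    proof (rule sum.cong)
      fix i assume "i \<in> {..n}"
      hence "u ^ n = u ^ (n - i) * u ^ i" by (simp flip: power_add)
      thus "u ^ (n - i) * coeff p i * (u * y) ^ i = u ^ n * (coeff p i * y ^ i)"
        by (simp add: power_mult_distrib mult_ac)
    qed simp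
    also have "\<dots> = u ^ n * poly p y"
      by (simp add: poly_altdef n_def sum_distrib_left)
    finally show ?thesis using p by simp
  qed
  ultimately show ?thesis unfolding is_integral_over_def by blast
qed

text \<open>Multiplying the integral equation of \<open>y\<close> by \<open>v ^ n\<close> and
  replacing \<open>v * y\<close> by \<open>u\<close> leaves a factor \<open>v\<close> in every term
  but \<open>u ^ n\<close>. This is how integrality enters the local arguments: a prime ideal of
  \<open>R\<close> containing \<open>v\<close> must contain \<open>u\<close>.\<close>

lemma is_integral_over_imp_dvd_power:
  fixes y :: "'a::field"
  assumes R: "subring_set R" and y: "is_integral_over R y"
    and u: "u \<in> R" and v: "v \<in> R" and uv: "v * y = u"
  obtains n w where "w \<in> R" "u ^ n = v * w"
proof -
  obtain p where p: "lead_coeff p = 1" "\<And>i. coeff p i \<in> R" "poly p y = 0"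
    using y by (auto simp: is_integral_over_def)
  define n where "n = degree p"
  define w where "w = - (\<Sum>i<n. coeff p i * v ^ (n - Suc i) * u ^ i)"
  have "w \<in> R"
    unfolding w_def using p(2) u v
    by (auto intro!: subring_setD[OF R] subring_set_power[OF R] subring_set_sum[OF R])
  moreover have "u ^ n = v * w"
  proof -
    have "0 = poly p y" using p by simp
    also have "\<dots> = (\<Sum>i<n. coeff p i * y ^ i) + y ^ n"
      using p(1) by (simp add: poly_altdef n_def flip: lessThan_Suc_atMost)
    finally have "y ^ n = - (\<Sum>i<n. coeff p i * y ^ i)" by (simp add: eq_neg_iff_add_eq_0 add.commute)
    hence "u ^ n = - (\<Sum>i<n. v ^ n * (coeff p i * y ^ i))"
      by (simp add: power_mult_distrib sum_distrib_left flip: uv)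
    also have "(\<Sum>i<n. v ^ n * (coeff p i * y ^ i)) = (\<Sum>i<n. v * (coeff p i * v ^ (n - Suc i) * u ^ i))"
    proof (rule sum.cong)
      fix i assume "i \<in> {..<n}"
      hence "n = Suc (n - Suc i) + i" by simp
      hence "v ^ n = v * v ^ (n - Suc i) * v ^ i" by (metis power_add power_Suc)
      thus "v ^ n * (coeff p i * y ^ i) = v * (coeff p i * v ^ (n - Suc i) * u ^ i)"
        by (simp add: power_mult_distrib mult_ac flip: uv)
    qed simp
    finally show ?thesis by (simp add: w_def sum_distrib_left)
  qed
  ultimately show ?thesis using that by blast
qed

section \<open>The ring \<open>\<int>[\<theta>]\<close> and polynomial division over the
  integers\<close>

lemma subring_set_int_adjoin: "subring_set (int_adjoin \<theta>)"
proof -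
  have "int_eval \<theta> 1 \<in> int_adjoin \<theta>" unfolding int_adjoin_def by blast
  moreover have "int_eval \<theta> (g - h) \<in> int_adjoin \<theta>" "int_eval \<theta> (g * h) \<in> int_adjoin \<theta>" for g h
    unfolding int_adjoin_def by blast+
  ultimately show ?thesis
    unfolding subring_set_def by (auto simp: int_adjoin_def hom_distribs)
qed

lemmas int_adjoin_closed = subring_setD[OF subring_set_int_adjoin]

lemma int_eval_in_int_adjoin [simp, intro]: "int_eval \<theta> h \<in> int_adjoin \<theta>"
  by (auto simp: int_adjoin_def)

lemma of_int_in_int_adjoin [simp, intro]: "of_int m \<in> int_adjoin \<theta>"
  using int_eval_in_int_adjoin[of "[:m:]" \<theta>] by (simp add: hom_distribs)

lemma self_in_int_adjoin: "\<theta> \<in> int_adjoin \<theta>"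
  using int_eval_in_int_adjoin[of "[:0, 1:]" \<theta>] by (simp add: hom_distribs)

lemma in_int_adjoinE:
  assumes "x \<in> int_adjoin \<theta>" obtains h where "x = int_eval \<theta> h"
  using assms by (auto simp: int_adjoin_def)

lemma in_int_adjoin_if_coprime_multiples:
  assumes "coprime m n" "of_int m * x \<in> int_adjoin \<theta>" "of_int n * x \<in> int_adjoin \<theta>"
  shows "x \<in> int_adjoin \<theta>"
proof -
  obtain u v where uv: "u * m + v * n = 1"
    using bezout_int[of m n] assms(1) by (metis coprime_iff_gcd_eq_1)
  have "x = of_int (u * m + v * n) * x" by (simp add: uv)
  also have "\<dots> = of_int u * (of_int m * x) + of_int v * (of_int n * x)"
    by (simp add: algebra_simps)
  also have "\<dots> \<in> int_adjoin \<theta>" using assms(2,3) by (blast intro: int_adjoin_closed(5,6))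
  finally show ?thesis .
qed

text \<open>Pseudo-division multiplies the dividend by a power of the leading coefficient of the
  divisor. For a monic divisor that power is 1, which gives true division over any commutative
  ring.\<close>

lemma monic_division:
  fixes f h :: "'a::comm_ring_1 poly"
  assumes "lead_coeff f = 1"
  obtains q r where "h = f * q + r" "r = 0 \<or> degree r < degree f"
proof -
  have "f \<noteq> 0" using assms by auto
  moreover obtain q r where "pseudo_divmod h f = (q, r)" by fastforce
  ultimately show ?thesis using pseudo_divmod[of f h q r] assms that by simp
qed

text \<open>Gauss's lemma: \<open>p\<close> stays prime in \<open>\<int>[x]\<close>, and it cannot
  divide a monic polynomial.\<close>

lemma const_prime_dvd_monic_mult:
  fixes p :: int
  assumes p: "prime p" and f: "lead_coeff f = 1" and d: "[:p:] dvd f * h"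
  shows "[:p:] dvd h"
proof -
  have "prime_elem [:p:]" using p by (intro lift_prime_elem_poly) auto
  hence "[:p:] dvd f \<or> [:p:] dvd h" using d by (simp add: prime_elem_dvd_mult_iff)
  moreover have "\<not> [:p:] dvd f"
  proof
    assume "[:p:] dvd f"
    hence "p dvd lead_coeff f" by (simp add: const_poly_dvd_iff)
    thus False using p f by auto
  qed
  ultimately show ?thesis by blast
qed

lemma clear_denominators:
  fixes q :: "rat poly"
  obtains m :: int and g where "m \<noteq> 0" "smult (of_int m) q = map_poly of_int g"
proof -
  have "\<exists>m g. m \<noteq> 0 \<and> smult (of_int m) q = map_poly of_int g"
  proof (induction q)
    case 0
    show ?case by (rule exI[of _ 1], rule exI[of _ 0]) simp
  next
    case (pCons c q)
    then obtain m g where g: "m \<noteq> 0" "smult (of_int m) q = map_poly of_int g" by blast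
    obtain n d where c: "c = of_int n / of_int d" "d \<noteq> 0"
      by (metis Fract_of_int_quotient Rat_cases less_irrefl)
    have "smult (of_int (d * m)) (pCons c q) = pCons (of_int (n * m)) (smult (of_int d) (smult (of_int m) q))"
      using c by simp
    also have "\<dots> = map_poly of_int (pCons (n * m) (smult d g))"
      unfolding g(2) by (simp add: hom_distribs)
    finally show ?case using g(1) c(2) by (metis mult_eq_0_iff)
  qed
  thus ?thesis using that by blast
qed

text \<open>The determinant trick: the powers of \<open>\<theta>\<close> below
  \<open>degree F\<close> span a module stable under multiplication by \<open>x\<close>, so
  \<open>x\<close> is an eigenvalue of an integer matrix, whose characteristic polynomial is monic
  over \<open>\<int>\<close>.\<close>

lemma algebraic_int_int_adjoin:
  fixes F :: "int poly"
  assumes monic: "lead_coeff F = 1" and deg: "degree F > 0" and root: "int_eval \<theta> F = 0"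
    and x: "x \<in> int_adjoin \<theta>"
  shows "algebraic_int x"
proof -
  obtain g where g: "x = int_eval \<theta> g" using x by (rule in_int_adjoinE)
  define n where "n = degree F"
  have "\<exists>r. F dvd monom 1 i * g - r \<and> degree r < n" for i
  proof -
    obtain q r where "monom 1 i * g = F * q + r" "r = 0 \<or> degree r < degree F"
      using monic by (rule monic_division)
    thus ?thesis using deg by (intro exI[of _ r]) (auto simp: n_def)
  qed
  then obtain r where r: "\<And>i. F dvd monom 1 i * g - r i" "\<And>i. degree (r i) < n" by metis
  have ev: "int_eval \<theta> (r i) = x * \<theta> ^ i" for i
  proof -
    have "int_eval \<theta> (monom 1 i * g - r i) = 0"
    proof -
      obtain k where "monom 1 i * g - r i = F * k" using r(1)[of i] by (auto elim: dvdE)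
      thus ?thesis by (simp only: of_int_poly_hom.hom_mult poly_mult root mult_zero_left)
    qed
    thus ?thesis by (simp add: hom_distribs poly_monom g mult.commute)
  qed
  \<comment> \<open>\<open>M\<close> is multiplication by \<open>x\<close> on the power basis, so \<open>(1, \<theta>, \<theta>\<^sup>2, \<dots>)\<close> is an eigenvector.\<close>
  define M where "M = mat n n (\<lambda>(i, j). coeff (r i) j)"
  define v where "v = vec n (\<lambda>i. \<theta> ^ i)"
  have M: "M \<in> carrier_mat n n" by (simp add: M_def)
  have M': "(map_mat of_int M :: complex mat) \<in> carrier_mat n n" using M by simp
  have "map_mat of_int M *\<^sub>v v = x \<cdot>\<^sub>v v"
  proof (rule eq_vecI)
    fix i assume "i < dim_vec (x \<cdot>\<^sub>v v)"
    hence i: "i < n" by (simp add: v_def)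
    have "(map_mat of_int M *\<^sub>v v) $ i = (\<Sum>j<n. of_int (coeff (r i) j) * \<theta> ^ j)"
      using i by (simp add: M_def v_def scalar_prod_def atLeast0LessThan)
    also have "\<dots> = (\<Sum>j\<le>degree (r i). of_int (coeff (r i) j) * \<theta> ^ j)"
      using r(2)[of i] by (intro sum.mono_neutral_right) (auto simp: coeff_eq_0)
    also have "\<dots> = x * \<theta> ^ i" by (simp flip: ev add: poly_altdef)
    finally show "(map_mat of_int M *\<^sub>v v) $ i = (x \<cdot>\<^sub>v v) $ i" using i by (simp add: v_def)
  qed (simp add: M_def v_def)
  \<comment> \<open>The coordinate of index 0 is \<open>\<theta> ^ 0 = 1\<close>, even for
    \<open>\<theta> = 0\<close>; it exists because \<open>degree F > 0\<close>.\<close>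
  moreover have "v \<noteq> 0\<^sub>v n"
  proof
    assume "v = 0\<^sub>v n"
    hence "v $ 0 = 0" using deg by (simp add: n_def)
    thus False using deg by (simp add: v_def n_def)
  qed
  ultimately have "eigenvalue (map_mat of_int M) x"
    unfolding eigenvalue_def eigenvector_def using M by (intro exI[of _ v]) (auto simp: v_def)
  hence "poly (char_poly (map_mat of_int M)) x = 0"
    using eigenvalue_root_char_poly[OF M'] by blast
  hence "int_eval x (char_poly M) = 0" by (simp add: of_int_hom.char_poly_hom[OF M])
  moreover have "lead_coeff (char_poly M) = 1" using degree_monic_char_poly[OF M] by simp
  ultimately show ?thesis unfolding algebraic_int_altdef_ipoly by blast
qed

section \<open>Integral closure and the ring of integers\<close>

lemma is_integral_over_algebraic_int:
  fixes R :: "complex set"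
  assumes "algebraic_int x" "subring_set R"
  shows "is_integral_over R x"
proof -
  have "\<int> \<subseteq> R"
  proof -
    have nat: "of_nat n \<in> R" for n by (induction n) (auto intro: subring_setD[OF assms(2)])
    have "of_int i \<in> R" for i
      using nat[of "nat i"] subring_setD(4)[OF assms(2) nat[of "nat (- i)"]] by (cases "i \<ge> 0") auto
    thus ?thesis by (auto elim: Ints_cases)
  qed
  thus ?thesis using assms(1) by (auto simp: is_integral_over_def algebraic_int.simps)
qed

lemma subfield_set_fraction_field_of:
  fixes R :: "'a::field set"
  assumes R: "subring_set R"
  shows "subfield_set (fraction_field_of R)"
  unfolding subfield_set_def
proof (intro conjI ballI)
  note cl = subring_setD[OF R]
  have mem: "x / y \<in> fraction_field_of R" if "x \<in> R" "y \<in> R" "y \<noteq> 0" for x y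
    using that by (auto simp: fraction_field_of_def)
  show "0 \<in> fraction_field_of R" "1 \<in> fraction_field_of R"
    using mem[of 0 1] mem[of 1 1] cl(1,2) by simp_all
  fix x assume "x \<in> fraction_field_of R"
  then obtain a b where x: "x = a / b" "a \<in> R" "b \<in> R" "b \<noteq> 0" by (auto simp: fraction_field_of_def)
  show "- x \<in> fraction_field_of R" using mem[OF cl(4)[OF x(2)] x(3,4)] x(1) by simp
  \<comment> \<open>Since \<open>inverse 0 = 0\<close>, the case \<open>a = 0\<close> is represented
    by \<open>0 / 1\<close> instead of \<open>b / a\<close>.\<close>
  show "inverse x \<in> fraction_field_of R"
    using mem[OF x(3,2)] mem[OF cl(1,2)] x(1) by (cases "a = 0") auto
  fix y assume "y \<in> fraction_field_of R"
  then obtain c d where y: "y = c / d" "c \<in> R" "d \<in> R" "d \<noteq> 0" by (auto simp: fraction_field_of_def)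
  have "x + y = (a * d + c * b) / (b * d)" "x * y = (a * c) / (b * d)"
    using x y by (simp_all add: field_simps)
  thus "x + y \<in> fraction_field_of R" "x * y \<in> fraction_field_of R"
    using mem[OF cl(5)[OF cl(6)[OF x(2) y(3)] cl(6)[OF y(2) x(3)]] cl(6)[OF x(3) y(3)]]
      mem[OF cl(6)[OF x(2) y(2)] cl(6)[OF x(3) y(3)]] x(4) y(4) by simp_all
qed

lemma subset_fraction_field_of: "1 \<in> R \<Longrightarrow> R \<subseteq> fraction_field_of R"
  unfolding fraction_field_of_def by (force intro: exI[of _ 1])

lemma rat_adjoin_subset_fraction_field: "rat_adjoin \<theta> \<subseteq> fraction_field_of (int_adjoin \<theta>)"
  unfolding rat_adjoin_def
  using subfield_set_fraction_field_of[OF subring_set_int_adjoin]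
    subset_fraction_field_of[OF int_adjoin_closed(2)] self_in_int_adjoin
  by (intro hull_minimal) auto

lemma int_adjoin_subset_subfield:
  assumes K: "subfield_set K" and "\<theta> \<in> K"
  shows "int_adjoin \<theta> \<subseteq> K"
proof -
  have nat: "of_nat n \<in> K" for n using K by (induction n) (auto simp: subfield_set_def)
  have int: "of_int i \<in> K" for i
  proof -
    have "- of_nat (nat (- i)) \<in> K" using K nat unfolding subfield_set_def by blast
    thus ?thesis using nat[of "nat i"] by (cases "i \<ge> 0") auto
  qed
  have "int_eval \<theta> h \<in> K" for h
  proof (induction h)
    case 0
    show ?case using K by (simp add: subfield_set_def)
  next
    case (pCons c h)
    thus ?case using K int[of c] assms(2) by (simp add: subfield_set_def hom_distribs)
  qed
  thus ?thesis by (auto simp: int_adjoin_def)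
qed

lemma int_adjoin_subset_rat_adjoin: "int_adjoin \<theta> \<subseteq> rat_adjoin \<theta>"
proof
  fix x assume x: "x \<in> int_adjoin \<theta>"
  show "x \<in> rat_adjoin \<theta>"
    unfolding rat_adjoin_def hull_def
    using int_adjoin_subset_subfield x by blast
qed

text \<open>An algebraic integer of the field is integral over the subring and lies in its fraction
  field, so closedness captures it. The converse inclusion is the determinant trick.\<close>

lemma ring_of_integers_eq_int_adjoin:
  fixes F :: "int poly"
  assumes F: "lead_coeff F = 1" "degree F > 0" "int_eval \<theta> F = 0"
    and closed: "integrally_closed_ring (int_adjoin \<theta>)"
  shows "ring_of_integers (rat_adjoin \<theta>) = int_adjoin \<theta>"
proof
  show "ring_of_integers (rat_adjoin \<theta>) \<subseteq> int_adjoin \<theta>"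
    using closed rat_adjoin_subset_fraction_field
      is_integral_over_algebraic_int[OF _ subring_set_int_adjoin]
    unfolding ring_of_integers_def integrally_closed_ring_def by blast
  show "int_adjoin \<theta> \<subseteq> ring_of_integers (rat_adjoin \<theta>)"
    using int_adjoin_subset_rat_adjoin algebraic_int_int_adjoin[OF F]
    by (auto simp: ring_of_integers_def)
qed

lemma additive_index_self:
  assumes "R \<noteq> {}" "\<And>x y. x \<in> R \<Longrightarrow> y \<in> R \<Longrightarrow> x - y \<in> R"
  shows "additive_index R R = 1"
proof -
  have "R // {(x, y). x \<in> R \<and> y \<in> R \<and> x - y \<in> R} = {R}"
    using assms by (auto simp: quotient_def)
  thus ?thesis by (simp add: additive_index_def)
qed

text \<open>The generator \<open>\<theta>\<close> itself contributes the index 1, and the gcd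
  divides it.\<close>

lemma field_index_eq_1:
  assumes "ring_of_integers (rat_adjoin \<theta>) = int_adjoin \<theta>"
  shows "field_index (rat_adjoin \<theta>) = 1"
proof -
  have "additive_index (int_adjoin \<theta>) (int_adjoin \<theta>) = 1"
    using int_adjoin_closed(2)[of \<theta>] by (intro additive_index_self int_adjoin_closed) auto
  hence "1 \<in> {additive_index (ring_of_integers (rat_adjoin \<theta>)) (int_adjoin \<theta>') | \<theta>'.
            \<theta>' \<in> ring_of_integers (rat_adjoin \<theta>) \<and> rat_adjoin \<theta> = rat_adjoin \<theta>'}"
    using assms self_in_int_adjoin[of \<theta>] by force
  hence "field_index (rat_adjoin \<theta>) dvd 1" unfolding field_index_def by (rule Gcd_dvd)
  thus ?thesis by simp
qed

section \<open>A Dedekind criterion\<close>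

text \<open>A factor of \<open>F\<close> modulo \<open>p\<close> is represented below by a prime
  ideal of \<open>\<int>[x]\<close> containing \<open>p\<close> and \<open>F\<close>, so that no
  polynomials over a finite field appear.\<close>

definition prime_ideal_set :: "'a::comm_ring_1 set \<Rightarrow> bool" where
  "prime_ideal_set I \<longleftrightarrow>
     0 \<in> I \<and> 1 \<notin> I \<and> (\<forall>x\<in>I. \<forall>y\<in>I. x + y \<in> I) \<and> (\<forall>x\<in>I. \<forall>y. y * x \<in> I) \<and>
     (\<forall>x y. x * y \<in> I \<longrightarrow> x \<in> I \<or> y \<in> I)"

lemma prime_ideal_setD:
  assumes "prime_ideal_set I"
  shows "1 \<notin> I" "x \<in> I \<Longrightarrow> y \<in> I \<Longrightarrow> x + y \<in> I" "x \<in> I \<Longrightarrow> y \<in> I \<Longrightarrow> x - y \<in> I"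
    "x \<in> I \<Longrightarrow> y * x \<in> I" "x \<in> I \<Longrightarrow> x * y \<in> I" "x * y \<in> I \<Longrightarrow> x \<in> I \<or> y \<in> I"
    "x ^ n \<in> I \<Longrightarrow> x \<in> I"
proof -
  show a: "\<And>x y. x \<in> I \<Longrightarrow> y \<in> I \<Longrightarrow> x + y \<in> I" and m: "\<And>x y. x \<in> I \<Longrightarrow> y * x \<in> I"
    and o: "1 \<notin> I" and pr: "\<And>x y. x * y \<in> I \<Longrightarrow> x \<in> I \<or> y \<in> I"
    using assms by (auto simp: prime_ideal_set_def)
  show "x - y \<in> I" if "x \<in> I" "y \<in> I" using a[OF that(1) m[OF that(2), of "-1"]] by simp
  show "x * y \<in> I" if "x \<in> I" using m[OF that, of y] by (simp add: mult.commute)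
  show "x ^ n \<in> I \<Longrightarrow> x \<in> I" using o by (induction n) (auto dest: pr)
qed

text \<open>The integers in \<open>I\<close> form a proper ideal containing \<open>p\<close>, and
  the ideal generated by a prime is maximal in \<open>\<int>\<close>.\<close>

lemma of_int_in_prime_ideal_iff:
  fixes p :: int and I :: "'a::comm_ring_1 set"
  assumes I: "prime_ideal_set I" and p: "prime p" "of_int p \<in> I"
  shows "of_int c \<in> I \<longleftrightarrow> p dvd c"
proof
  assume "p dvd c"
  then obtain k where "c = p * k" by blast
  thus "of_int c \<in> I" using prime_ideal_setD(5)[OF I p(2)] by simp
next
  assume c: "of_int c \<in> I"
  show "p dvd c"
  proof (rule ccontr)
    assume "\<not> p dvd c"
    hence "coprime p c" using p(1) by (simp add: prime_imp_coprime)
    then obtain u v where "u * p + v * c = 1" using bezout_int[of p c] by auto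
    hence "of_int u * of_int p + of_int v * of_int c = (1 :: 'a)"
      by (metis of_int_1 of_int_add of_int_mult)
    thus False using prime_ideal_setD[OF I] p(2) c by metis
  qed
qed

locale monic_integer_root =
  fixes F :: "int poly" and \<alpha> :: complex
  assumes monic: "lead_coeff F = 1"
    and irr: "irreducible (map_poly rat_of_int F)"
    and root: "int_eval \<alpha> F = 0"
begin

abbreviation A :: "complex set" where "A \<equiv> int_adjoin \<alpha>"

section \<open>The kernel of evaluation at \<open>\<alpha>\<close>\<close>

lemma degree_pos: "degree F > 0"
proof (rule ccontr)
  assume "\<not> degree F > 0"
  hence "F = 1" using monic by (metis One_nat_def degree_eq_zeroE gr0I lead_coeff_pCons(2) one_pCons pCons_0_0 coeff_pCons_0)
  thus False using irr by simp
qed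

text \<open>Irreducibility gives a Bezout identity over \<open>\<rat>\<close>; clearing its
  denominators leaves a non-zero integer, much like a resultant.\<close>

lemma bezout_constant:
  assumes "\<not> F dvd h"
  obtains u w m where "m \<noteq> 0" "u * F + w * h = [:m:]"
proof -
  let ?Q = "map_poly rat_of_int"
  have "\<not> ?Q F dvd ?Q h"
  proof
    assume dvd: "?Q F dvd ?Q h"
    obtain q r where qr: "h = F * q + r" "r = 0 \<or> degree r < degree F"
      using monic by (rule monic_division)
    have "?Q F dvd ?Q F * ?Q q + ?Q r" using dvd by (simp add: qr(1) hom_distribs)
    hence "?Q F dvd ?Q r" by (metis dvd_add_right_iff dvd_triv_left)
    moreover have "r \<noteq> 0" using assms qr(1) by auto
    ultimately have "degree F \<le> degree r"
      using dvd_imp_degree_le[of "?Q F" "?Q r"] by simp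
    thus False using qr(2) \<open>r \<noteq> 0\<close> by simp
  qed
  hence "coprime (?Q F) (?Q h)"
    using irr by (intro prime_elem_imp_coprime irreducible_imp_prime_elem_gcd)
  hence "gcd (?Q F) (?Q h) = 1" by simp
  then obtain s t where st: "s * ?Q F + t * ?Q h = 1"
    using bezout_coefficients_fst_snd[of "?Q F" "?Q h"] by metis
  obtain k u where u: "k \<noteq> 0" "smult (of_int k) s = ?Q u" by (rule clear_denominators)
  obtain l w where w: "l \<noteq> 0" "smult (of_int l) t = ?Q w" by (rule clear_denominators)
  have "?Q (smult l u * F + smult k w * h) = smult (of_int (k * l)) (s * ?Q F + t * ?Q h)"
    by (simp add: hom_distribs smult_add_right mult.commute flip: u(2) w(2))
  also have "\<dots> = ?Q [:k * l:]" by (simp add: st hom_distribs)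
  finally have "smult l u * F + smult k w * h = [:k * l:]"
    by (simp only: of_int_poly_hom.eq_iff)
  thus ?thesis by (rule that[rotated]) (use u(1) w(1) in simp)
qed

text \<open>If \<open>F\<close> did not divide a polynomial vanishing at \<open>\<alpha>\<close>,
  evaluating the Bezout identity at \<open>\<alpha>\<close> would make its non-zero constant vanish.
  Hence \<open>\<int>[\<alpha>]\<close> is \<open>\<int>[x]\<close> modulo \<open>F\<close>.\<close>

lemma int_eval_eq_0_iff: "int_eval \<alpha> h = 0 \<longleftrightarrow> F dvd h"
proof
  assume "F dvd h"
  then obtain k where "h = F * k" by (auto elim: dvdE)
  thus "int_eval \<alpha> h = 0" by (simp add: hom_distribs root)
next
  assume h: "int_eval \<alpha> h = 0"
  show "F dvd h"
  proof (rule ccontr)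
    assume "\<not> F dvd h"
    then obtain u w m where m: "m \<noteq> 0" "u * F + w * h = [:m:]" by (rule bezout_constant)
    have "int_eval \<alpha> (u * F + w * h) = 0" by (simp add: hom_distribs root h)
    thus False using m by (simp add: hom_distribs)
  qed
qed

lemma int_eval_eq_iff: "int_eval \<alpha> g = int_eval \<alpha> h \<longleftrightarrow> F dvd g - h"
  using int_eval_eq_0_iff[of "g - h"] by (simp add: hom_distribs)

text \<open>By the Bezout identity every non-zero element of \<open>\<int>[\<alpha>]\<close> divides
  a non-zero integer, so denominators may be taken in \<open>\<int>\<close>.\<close>

lemma fraction_field_int_multiple:
  assumes "y \<in> fraction_field_of A"
  obtains m :: nat where "m > 0" "of_nat m * y \<in> A"
proof -
  obtain u v where uv: "y = u / v" "u \<in> A" "v \<in> A" "v \<noteq> 0"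
    using assms by (auto simp: fraction_field_of_def)
  obtain h where h: "v = int_eval \<alpha> h" using uv(3) by (rule in_int_adjoinE)
  hence "\<not> F dvd h" using uv(4) int_eval_eq_0_iff by simp
  then obtain k w m where m: "m \<noteq> 0" "k * F + w * h = [:m:]" by (rule bezout_constant)
  have "int_eval \<alpha> (k * F + w * h) = of_int m" by (simp add: m hom_distribs)
  hence "int_eval \<alpha> w * v = of_int m" by (simp add: hom_distribs root h)
  hence "of_int m * y = int_eval \<alpha> w * (v * y)" by (simp flip: mult.assoc)
  also have "v * y = u" using uv by simp
  finally have "of_int m * y = int_eval \<alpha> w * u" .
  hence *: "of_int m * y \<in> A" using uv(2) by (simp add: int_adjoin_closed)
  have "of_int \<bar>m\<bar> * y \<in> A"
    using * int_adjoin_closed(4)[OF *] by (cases "m \<ge> 0") auto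
  hence "of_nat (nat \<bar>m\<bar>) * y \<in> A" by (simp add: of_nat_nat)
  thus ?thesis using that[of "nat \<bar>m\<bar>"] m(1) by simp
qed

text \<open>With \<open>S = (F - F(r)) / (x - r)\<close>, the element \<open>S(\<alpha>) / p\<close> is a root of a monic quadratic over
  \<open>\<int>[\<alpha>]\<close>.\<close>

lemma not_integrally_closed:
  fixes p r :: int
  assumes p: "prime p" and Fr: "p ^ 2 dvd poly F r" and F'r: "p dvd poly (pderiv F) r"
  shows "\<not> integrally_closed_ring A"
proof
  assume closed: "integrally_closed_ring A"
  \<comment> \<open>Dividing twice by \<open>x - r\<close> exposes the first two Taylor coefficients
    of \<open>F\<close> at \<open>r\<close>: the remainders are \<open>F(r)\<close> and
    \<open>S(r) = F'(r)\<close>.\<close>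
  define S where "S = synthetic_div F r"
  define H where "H = synthetic_div S r"
  have F_eq: "F = [:- r, 1:] * S + [:poly F r:]" 
    unfolding S_def by (rule synthetic_div_correct'[symmetric])
  have S_eq: "S = [:- r, 1:] * H + [:poly S r:]" 
    unfolding H_def by (rule synthetic_div_correct'[symmetric])
  have "pderiv F = pderiv ([:- r, 1:] * S + [:poly F r:])" using F_eq by simp
  also have "\<dots> = [:- r, 1:] * pderiv S + S"
    unfolding pderiv_add pderiv_mult by (simp add: pderiv_pCons)
  finally have "poly (pderiv F) r = poly S r" by simp
  then obtain c where c: "poly S r = p * c" using F'r by (auto elim: dvdE)
  obtain d where d: "poly F r = p ^ 2 * d" using Fr by (auto elim: dvdE)
  have degS: "degree S < degree F" using degree_pos by (simp add: S_def degree_synthetic_div)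
  have "coeff F (degree F) = coeff S (degree F - 1)"
  proof -
    have "coeff F (degree F) = coeff ([:- r, 1:] * S + [:poly F r:]) (degree F)" using F_eq by simp
    also have "\<dots> = coeff S (degree F - 1)"
      using degree_pos degS by (cases "degree F") (simp_all add: coeff_eq_0)
    finally show ?thesis .
  qed
  hence lcS: "coeff S (degree F - 1) = 1" using monic by simp
  define s where "s = int_eval \<alpha> S"
  have "int_eval \<alpha> ([:- r, 1:] * S + [:poly F r:]) = 0" using root F_eq by simp
  hence s1: "(\<alpha> - of_int r) * s = - (of_int p ^ 2 * of_int d)"
    by (simp add: hom_distribs s_def d algebra_simps eq_neg_iff_add_eq_0)
  have "s = int_eval \<alpha> ([:- r, 1:] * H + [:poly S r:])" using S_eq by (simp add: s_def)
  hence s2: "s = (\<alpha> - of_int r) * int_eval \<alpha> H + of_int p * of_int c"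
    by (simp add: hom_distribs c algebra_simps)
  define \<beta> where "\<beta> = s / of_int p"
  have p0: "of_int p \<noteq> (0::complex)" using p by auto
  \<comment> \<open>One factor \<open>s\<close> is expanded by \<open>s2\<close>, after which
    \<open>s1\<close> turns \<open>(\<alpha> - r) * s\<close> into a multiple of
    \<open>p ^ 2\<close>. Division by \<open>p ^ 2\<close> leaves the monic quadratic for
    \<open>\<beta>\<close>.\<close>
  have "s * s = ((\<alpha> - of_int r) * s) * int_eval \<alpha> H + of_int p * of_int c * s"
    by (subst (2) s2) (simp add: algebra_simps)
  hence quad: "\<beta> ^ 2 - of_int c * \<beta> + of_int d * int_eval \<alpha> H = 0"
    unfolding s1 using p0 by (simp add: \<beta>_def field_simps power2_eq_square)
  have "is_integral_over A \<beta>"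
    unfolding is_integral_over_def
  proof (intro exI[of _ "[:of_int d * int_eval \<alpha> H, - of_int c, 1:]"] conjI allI)
    show "coeff [:of_int d * int_eval \<alpha> H, - of_int c, 1:] i \<in> A" for i
      by (auto simp: coeff_pCons int_adjoin_closed split: nat.splits)
    show "poly [:of_int d * int_eval \<alpha> H, - of_int c, 1:] \<beta> = 0"
      using quad by (simp add: algebra_simps power2_eq_square)
  qed simp
  moreover have "\<beta> \<in> fraction_field_of A"
    unfolding fraction_field_of_def
    by (intro CollectI exI[of _ s] exI[of _ "of_int p"]) (use p0 \<beta>_def s_def in blast)
  ultimately have "\<beta> \<in> A" using closed by (simp add: integrally_closed_ring_def)
  then obtain g where \<beta>: "\<beta> = int_eval \<alpha> g" by (rule in_int_adjoinE)
  have "s = of_int p * \<beta>" using p0 by (simp add: \<beta>_def)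
  hence "int_eval \<alpha> S = int_eval \<alpha> (smult p g)" by (simp only: \<beta> s_def hom_distribs poly_smult)
  \<comment> \<open>Reducing \<open>g\<close> modulo \<open>F\<close> makes
    \<open>S - smult p t\<close> too small in degree to be a non-zero multiple of \<open>F\<close>;
    but \<open>S\<close> is monic and so is not divisible by \<open>p\<close>.\<close>
  obtain q t where g: "g = F * q + t" "t = 0 \<or> degree t < degree F"
    using monic by (rule monic_division)
  have "F dvd S - smult p g" using \<open>int_eval \<alpha> S = _\<close> int_eval_eq_iff by blast
  also have "S - smult p g = (S - smult p t) - F * smult p q" by (simp add: g smult_add_right)
  finally have dvd: "F dvd S - smult p t" by (metis dvd_diff_left_iff dvd_triv_left)
  have "degree (smult p t) < degree F" using g(2) degree_pos p by auto
  hence "degree (S - smult p t) < degree F" using degS by (rule degree_diff_less[rotated])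
  hence "S - smult p t = 0" using dvd by (meson dvd_imp_degree_le not_le)
  hence "coeff S (degree F - 1) = p * coeff t (degree F - 1)" by simp
  hence "p dvd 1" using lcS by (metis dvd_triv_left)
  thus False using p by auto
qed

section \<open>Conductors of integral elements\<close>

definition conductor :: "complex \<Rightarrow> int poly set" where
  "conductor z = {h. int_eval \<alpha> h * z \<in> A}"

lemma conductor_iff: "h \<in> conductor z \<longleftrightarrow> int_eval \<alpha> h * z \<in> A"
  by (simp add: conductor_def)

lemma conductor_add: "g \<in> conductor z \<Longrightarrow> h \<in> conductor z \<Longrightarrow> g + h \<in> conductor z"
  by (simp add: conductor_iff hom_distribs distrib_right int_adjoin_closed)

lemma conductor_diff: "g \<in> conductor z \<Longrightarrow> h \<in> conductor z \<Longrightarrow> g - h \<in> conductor z"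
  by (simp add: conductor_iff hom_distribs left_diff_distrib int_adjoin_closed)

lemma conductor_mult: "h \<in> conductor z \<Longrightarrow> g * h \<in> conductor z"
  by (simp add: conductor_iff hom_distribs mult.assoc int_adjoin_closed)

lemma conductor_mult_right: "h \<in> conductor z \<Longrightarrow> h * g \<in> conductor z"
  using conductor_mult[of h z g] by (simp add: mult.commute)

text \<open>Conductors are taken in \<open>\<int>[x]\<close> instead of
  \<open>\<int>[\<alpha>]\<close>, so each contains a monic polynomial and a choice by least degree
  is possible.\<close>

lemma root_in_conductor: "F \<in> conductor z"
  by (simp add: conductor_iff root int_adjoin_closed)

text \<open>For prime \<open>p\<close>, these are the elements whose class has order
  \<open>p\<close> in the integral closure modulo \<open>\<int>[\<alpha>]\<close>; the condition on
  \<open>of_int p * z\<close> also places \<open>z\<close> in the fraction field.\<close>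

definition p_defect :: "int \<Rightarrow> complex \<Rightarrow> bool" where
  "p_defect p z \<longleftrightarrow> is_integral_over A z \<and> z \<notin> A \<and> of_int p * z \<in> A"

lemma p_defect_conductor: "p_defect p z \<Longrightarrow> smult p h \<in> conductor z"
  by (simp add: p_defect_def conductor_iff hom_distribs mult.assoc mult.left_commute[of "of_int p"]
      int_adjoin_closed)

text \<open>This stands in for the principality of the ideals of \<open>\<bbbF>\<^sub>p[x]\<close>.\<close>

lemma conductor_generator:
  assumes p: "prime p" and f: "lead_coeff f = 1" and z: "p_defect p z" "f \<in> conductor z"
    and min: "\<And>g. lead_coeff g = 1 \<Longrightarrow> g \<in> conductor z \<Longrightarrow> degree f \<le> degree g"
    and h: "h \<in> conductor z"
  obtains q s where "h = f * q + smult p s"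
proof -
  \<comment> \<open>A leading coefficient divisible by \<open>p\<close> can be stripped off; any
    other could be turned into 1 inside the conductor, against the minimality of
    \<open>f\<close>.\<close>
  have small: "[:p:] dvd r" if "r \<in> conductor z" "degree r < degree f" for r
    using that
  proof (induction "degree r" arbitrary: r rule: less_induct)
    case less
    show ?case
    proof (cases "p dvd lead_coeff r")
      case True
      define r' where "r' = r - monom (lead_coeff r) (degree r)"
      have pm: "[:p:] dvd monom (lead_coeff r) (degree r)"
        using True by (simp add: const_poly_dvd_iff)
      have "[:p:] dvd r'"
      \<comment> \<open>In degree 0 stripping the leading term leaves zero; the degree cannot drop,
        so the induction hypothesis would not apply.\<close>
      proof (cases "r' = 0 \<or> degree r = 0")
        case True
        have "r' = 0"
        proof (cases "degree r = 0")
          case True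
          thus ?thesis unfolding r'_def by (metis degree_eq_zeroE diff_self lead_coeff_monom monom_0 coeff_pCons_0)
        qed (use True in simp)
        thus ?thesis by simp
      next
        case False
        have "degree r' < degree r"
        proof -
          have "coeff r' i = 0" if "i \<ge> degree r" for i
            using that by (auto simp: r'_def coeff_eq_0)
          thus ?thesis using False by (metis leading_coeff_0_iff not_le)
        qed
        moreover have "monom (lead_coeff r) (degree r) \<in> conductor z"
          using pm p_defect_conductor[OF z(1)] by (auto elim!: dvdE)
        hence "r' \<in> conductor z" unfolding r'_def using less.prems conductor_diff by blast
        ultimately show ?thesis using less by auto
      qed
      thus ?thesis using pm by (simp add: r'_def dvd_diff_left_iff)
    next
      case False
      hence "coprime p (lead_coeff r)" using p prime_imp_coprime by blast
      then obtain u v where uv: "u * p + v * lead_coeff r = 1"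
        using bezout_int[of p "lead_coeff r"] by (metis coprime_iff_gcd_eq_1)
      define g where "g = [:v:] * r + smult p (monom u (degree r))"
      have "g \<in> conductor z"
        unfolding g_def using less.prems p_defect_conductor[OF z(1)] conductor_add conductor_mult by blast
      moreover have cg: "coeff g (degree r) = 1" using uv by (simp add: g_def algebra_simps)
      moreover have "degree g \<le> degree r"
        unfolding g_def by (intro degree_add_le) (auto simp: degree_monom_le degree_smult_le
          intro: order.trans[OF degree_smult_le])
      ultimately have "degree g = degree r" using le_degree[of g "degree r"] by simp
      hence "degree f \<le> degree r" using min[of g] cg \<open>g \<in> conductor z\<close> by simp
      thus ?thesis using less.prems by simp
    qed
  qed
  obtain q r where qr: "h = f * q + r" "r = 0 \<or> degree r < degree f"
    using f by (rule monic_division)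
  have "r = h - f * q" using qr by simp
  hence "r \<in> conductor z" using h z(2) conductor_diff conductor_mult_right by blast
  hence "[:p:] dvd r" using qr(2) small by auto
  then obtain s where "r = [:p:] * s" by (auto elim: dvdE)
  thus ?thesis using that qr(1) by simp
qed

text \<open>Choosing \<open>z\<close> so that its conductor contains a monic polynomial of least possible degree makes
  the conductor a maximal ideal. Integrality of \<open>z\<close> then forces \<open>F\<close> into the square of that ideal
  modulo \<open>p\<close>, hence \<open>F'\<close> into the ideal.\<close>

lemma exists_prime_conductor:
  assumes p: "prime p" and y: "p_defect p y"
  obtains z where "p_defect p z" "prime_ideal_set (conductor z)" "pderiv F \<in> conductor z"
proof -
  define P where "P n \<longleftrightarrow> (\<exists>z f. p_defect p z \<and> lead_coeff f = 1 \<and> f \<in> conductor z \<and> degree f = n)" for n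
  have "P (degree F)" unfolding P_def using y monic root_in_conductor by blast
  hence "P (LEAST n. P n)" by (rule LeastI)
  then obtain z f where z: "p_defect p z" and f: "lead_coeff f = 1" "f \<in> conductor z" "degree f = (LEAST n. P n)"
    unfolding P_def by blast
  have min: "degree f \<le> degree g" if "p_defect p z'" "lead_coeff g = 1" "g \<in> conductor z'" for z' g
    unfolding f(3) by (rule Least_le) (use that P_def in blast)
  have gen: "\<exists>q s. h = f * q + smult p s" if "p_defect p z'" "f \<in> conductor z'" "h \<in> conductor z'" for z' h
    using conductor_generator[OF p f(1) that(1,2) min[OF that(1)] that(3)] by metis
  note pI = p_defect_conductor[OF z]
  have I: "prime_ideal_set (conductor z)"
    unfolding prime_ideal_set_def
  proof (intro conjI ballI allI impI)
    show "0 \<in> conductor z" using pI[of 0] by simp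
    show "1 \<notin> conductor z" using z by (simp add: conductor_iff p_defect_def)
    show "g + h \<in> conductor z" if "g \<in> conductor z" "h \<in> conductor z" for g h
      using that by (rule conductor_add)
    show "g * h \<in> conductor z" if "h \<in> conductor z" for g h using that by (rule conductor_mult)
    show "g \<in> conductor z \<or> h \<in> conductor z" if gh: "g * h \<in> conductor z" for g h
    proof (rule disjCI)
      assume h: "h \<notin> conductor z"
      \<comment> \<open>Passing from \<open>z\<close> to \<open>h(\<alpha>) z\<close> can only
        enlarge the conductor, yet by minimality it is still generated by \<open>f\<close> and
        \<open>p\<close>.\<close>
      define z' where "z' = int_eval \<alpha> h * z"
      have "of_int p * z' = int_eval \<alpha> h * (of_int p * z)" by (simp add: z'_def)
      also have "\<dots> \<in> A" using z unfolding p_defect_def by (blast intro: int_adjoin_closed)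
      finally have "of_int p * z' \<in> A" .
      hence z': "p_defect p z'"
        using z h is_integral_over_mult[OF subring_set_int_adjoin]
        by (auto simp: p_defect_def z'_def conductor_iff)
      have "f \<in> conductor z'"
        using conductor_mult_right[OF f(2), of h] by (simp add: conductor_iff z'_def hom_distribs mult.assoc)
      moreover have "g \<in> conductor z'"
        using gh by (simp add: conductor_iff z'_def hom_distribs mult.assoc)
      ultimately obtain q s where "g = f * q + smult p s" using gen[OF z'] by blast
      thus "g \<in> conductor z" using f(2) pI conductor_add conductor_mult_right by blast
    qed
  qed
  \<comment> \<open>With \<open>p z = g(\<alpha>)\<close>,
    \<open>f(\<alpha>) z = l(\<alpha>)\<close> and \<open>F = f k + p s\<close>, comparing
    \<open>f g\<close> with \<open>p l\<close> modulo \<open>F\<close> gives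
    \<open>g = k m + p t\<close>. The aim is to show that \<open>k\<close> lies in the
    conductor.\<close>
  obtain g where g: "of_int p * z = int_eval \<alpha> g" using z by (auto simp: p_defect_def elim: in_int_adjoinE)
  obtain l where l: "int_eval \<alpha> f * z = int_eval \<alpha> l"
    using f(2) by (auto simp: conductor_iff elim: in_int_adjoinE)
  obtain k s where F: "F = f * k + smult p s" using gen[OF z f(2) root_in_conductor] by blast
  have "int_eval \<alpha> (f * g) = int_eval \<alpha> (smult p l)"
    by (simp add: hom_distribs mult.left_commute flip: g l)
  then obtain m where "f * g - smult p l = F * m" using int_eval_eq_iff by (metis dvdE)
  hence "f * (g - k * m) = [:p:] * (l + s * m)" by (simp add: F algebra_simps smult_add_right)
  hence "[:p:] dvd g - k * m"
    using const_prime_dvd_monic_mult[OF p f(1)] by (metis dvd_triv_left)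
  then obtain t where t: "g = k * m + smult p t" by (auto elim!: dvdE simp: algebra_simps)
  \<comment> \<open>Integrality is used here: a power of \<open>g(\<alpha>)\<close> is
    \<open>p w\<close> with \<open>w\<close> in \<open>A\<close>, and \<open>w * (p z)\<close> lies
    in \<open>A\<close>. Primeness then removes the exponent.\<close>
  have "g \<in> conductor z"
  proof -
    obtain n w where w: "w \<in> A" "int_eval \<alpha> g ^ n = of_int p * w"
      using is_integral_over_imp_dvd_power[OF subring_set_int_adjoin _ int_eval_in_int_adjoin
          of_int_in_int_adjoin g] z
      unfolding p_defect_def by blast
    have "int_eval \<alpha> (g ^ n) * z = w * (of_int p * z)"
      by (simp add: hom_distribs w(2))
    also have "\<dots> \<in> A" using w(1) z by (auto simp: p_defect_def intro: int_adjoin_closed)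
    finally have "g ^ n \<in> conductor z" by (simp add: conductor_iff)
    thus ?thesis by (rule prime_ideal_setD(7)[OF I])
  qed
  hence "k * m \<in> conductor z" using conductor_diff[OF _ pI[of t]] t by (metis add_diff_cancel_right')
  hence "k \<in> conductor z \<or> m \<in> conductor z" by (rule prime_ideal_setD(6)[OF I])
  \<comment> \<open>If \<open>m\<close> were a combination of \<open>f\<close> and \<open>p\<close>,
    then \<open>g\<close> would be a multiple of \<open>p\<close> modulo \<open>F\<close>, and
    cancelling \<open>p\<close> would put \<open>z\<close> into \<open>A\<close>.\<close>
  moreover have "m \<notin> conductor z"
  proof
    assume "m \<in> conductor z"
    then obtain q u where m: "m = f * q + smult p u" using gen[OF z f(2)] by blast
    have "g = F * q + smult p (k * u + t - s * q)"
      by (simp add: t m F algebra_simps smult_add_right smult_diff_right)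
    hence "of_int p * z = of_int p * int_eval \<alpha> (k * u + t - s * q)"
      using g root by (simp add: hom_distribs)
    hence "z = int_eval \<alpha> (k * u + t - s * q)" using p by auto
    thus False using z by (auto simp: p_defect_def)
  qed
  ultimately obtain q u where k: "k = f * q + smult p u" using gen[OF z f(2)] by blast
  \<comment> \<open>Now \<open>f ^ 2\<close> divides \<open>F\<close> modulo \<open>p\<close>, so
    \<open>f\<close> divides the derivative modulo \<open>p\<close>.\<close>
  have "F = f * (f * q) + smult p (s + f * u)" by (simp add: F k algebra_simps smult_add_right)
  hence "pderiv F = f * (pderiv (f * q) + pderiv f * q) + smult p (pderiv (s + f * u))"
    by (simp add: pderiv_add pderiv_smult pderiv_mult[of f "f * q"] algebra_simps)
  hence "pderiv F \<in> conductor z" using f(2) pI conductor_add conductor_mult_right by metis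
  thus ?thesis using that z I by blast
qed

text \<open>If \<open>F(r) = p d\<close> with \<open>p\<close> not dividing \<open>d\<close>, then
  \<open>p d = - (\<alpha> - r) H(\<alpha>)\<close>, so up to the factor \<open>d\<close> the ideal
  \<open>(p, \<alpha> - r)\<close> is generated by \<open>\<alpha> - r\<close>. Integrality puts
  \<open>(\<alpha> - r) z\<close> into this ideal; cancelling \<open>\<alpha> - r\<close> gives
  \<open>d z\<close> in \<open>A\<close>, which together with \<open>p z\<close> in \<open>A\<close>
  forces \<open>z\<close> into \<open>A\<close>.\<close>

lemma linear_conductor:
  assumes p: "prime p" and z: "p_defect p z" and lin: "[:- r, 1:] \<in> conductor z"
    and Fr: "p dvd poly F r"
  shows "p ^ 2 dvd poly F r"
proof (rule ccontr)
  assume not: "\<not> p ^ 2 dvd poly F r"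
  obtain d where d: "poly F r = p * d" using Fr by (auto elim: dvdE)
  hence "\<not> p dvd d" using not by (auto simp: power2_eq_square)
  hence pd: "coprime p d" using p prime_imp_coprime by blast
  have "\<alpha> \<noteq> of_int r"
  proof
    assume "\<alpha> = of_int r"
    hence "of_int (poly F r) = (0 :: complex)" using root by simp
    thus False using not by simp
  qed
  have ev_lin: "int_eval \<alpha> [:- r, 1:] = \<alpha> - of_int r" by (simp add: hom_distribs)
  obtain q where q: "(\<alpha> - of_int r) * z = int_eval \<alpha> q"
    using lin unfolding conductor_iff ev_lin by (rule in_int_adjoinE)
  have zint: "is_integral_over A z" using z by (simp add: p_defect_def)
  have "\<alpha> - of_int r \<in> A" using self_in_int_adjoin by (auto intro: int_adjoin_closed)
  then obtain n w' where "w' \<in> A" "int_eval \<alpha> q ^ n = (\<alpha> - of_int r) * w'"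
    using is_integral_over_imp_dvd_power[OF subring_set_int_adjoin zint int_eval_in_int_adjoin _ q] by blast
  then obtain w where "int_eval \<alpha> q ^ n = (\<alpha> - of_int r) * int_eval \<alpha> w" by (auto elim: in_int_adjoinE)
  hence "int_eval \<alpha> (q ^ n) = int_eval \<alpha> ([:- r, 1:] * w)"
    unfolding ev_lin[symmetric] by (simp only: hom_distribs poly_mult poly_power)
  then obtain k where "q ^ n - [:- r, 1:] * w = F * k" using int_eval_eq_iff by (metis dvdE)
  \<comment> \<open>Evaluation at \<open>r\<close> kills the multiple of \<open>x - r\<close> and
    turns the relation modulo \<open>F\<close> into one modulo \<open>F(r)\<close>.\<close>
  hence "poly (q ^ n - [:- r, 1:] * w) r = poly (F * k) r" by simp
  hence "poly q r ^ n = poly F r * poly k r" by simp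
  hence "p dvd poly q r ^ n" using Fr by simp
  hence "p dvd poly q r" using p prime_dvd_power by blast
  then obtain t where t: "poly q r = p * t" by (auto elim: dvdE)
  define Q where "Q = synthetic_div q r"
  define H where "H = synthetic_div F r"
  have "int_eval \<alpha> q = int_eval \<alpha> ([:- r, 1:] * Q + [:poly q r:])"
    unfolding Q_def by (simp only: synthetic_div_correct')
  also have "\<dots> = (\<alpha> - of_int r) * int_eval \<alpha> Q + of_int p * of_int t"
    by (simp add: t hom_distribs algebra_simps)
  finally have e1: "(\<alpha> - of_int r) * z = (\<alpha> - of_int r) * int_eval \<alpha> Q + of_int p * of_int t"
    unfolding q .
  have "int_eval \<alpha> ([:- r, 1:] * H + [:poly F r:]) = 0"
    using root by (simp only: H_def synthetic_div_correct')
  hence e2: "of_int p * of_int d = - ((\<alpha> - of_int r) * int_eval \<alpha> H)"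
    by (simp add: d hom_distribs algebra_simps eq_neg_iff_add_eq_0)
  have "(\<alpha> - of_int r) * (of_int d * z) = of_int d * ((\<alpha> - of_int r) * z)" by simp
  also have "\<dots> = (\<alpha> - of_int r) * (of_int d * int_eval \<alpha> Q) + of_int t * (of_int p * of_int d)"
    unfolding e1 by (simp add: algebra_simps)
  also have "\<dots> = (\<alpha> - of_int r) * (of_int d * int_eval \<alpha> Q - of_int t * int_eval \<alpha> H)"
    unfolding e2 by (simp add: algebra_simps)
  finally have "of_int d * z = of_int d * int_eval \<alpha> Q - of_int t * int_eval \<alpha> H"
    using \<open>\<alpha> \<noteq> of_int r\<close> by (simp only: mult_cancel_left) simp
  hence "of_int d * z \<in> A" by (auto intro: int_adjoin_closed)
  hence "z \<in> A" using in_int_adjoin_if_coprime_multiples[OF pd] z unfolding p_defect_def by blast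
  thus False using z by (simp add: p_defect_def)
qed

text \<open>If \<open>m\<close> is the least positive integer denominator of an offending
  \<open>y\<close> and \<open>q\<close> is a prime factor of \<open>m\<close>, then
  \<open>(m / q) y\<close> is still outside \<open>A\<close>, but \<open>q\<close> times it is
  inside.\<close>

lemma exists_p_defect:
  assumes "\<not> integrally_closed_ring A"
  obtains p z where "prime p" "p_defect p z"
proof -
  obtain y where y: "y \<in> fraction_field_of A" "is_integral_over A y" "y \<notin> A"
    using assms by (auto simp: integrally_closed_ring_def)
  define P where "P m \<longleftrightarrow> m > 0 \<and> of_nat m * y \<in> A" for m :: nat
  have ex: "\<exists>m. P m" using fraction_field_int_multiple[OF y(1)] unfolding P_def by metis
  define m where "m = (LEAST m. P m)"
  have m: "P m" unfolding m_def using ex by (rule LeastI_ex)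
  have min: "m \<le> k" if "P k" for k unfolding m_def using that by (rule Least_le)
  have "m \<noteq> 1" using m y(3) by (auto simp: P_def)
  then obtain q where q: "prime q" "q dvd m" using prime_factor_nat by blast
  then obtain k where k: "m = q * k" by blast
  have "k > 0" "k < m" using m prime_gt_1_nat[OF q(1)] k by (auto simp: P_def)
  define z where "z = of_nat k * y"
  have "z \<notin> A" using min[of k] \<open>k > 0\<close> \<open>k < m\<close> by (auto simp: P_def z_def)
  moreover have "of_nat k \<in> A" using of_int_in_int_adjoin[of "int k"] by simp
  hence "is_integral_over A z"
    unfolding z_def using is_integral_over_mult[OF subring_set_int_adjoin y(2)] by blast
  moreover have "of_int (int q) * z \<in> A" using m by (simp add: P_def k z_def mult.assoc)
  ultimately show ?thesis using that[of "int q" z] q(1) by (simp add: p_defect_def)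
qed

text \<open>Dedekind's criterion, in the case where every repeated factor of \<open>F\<close> modulo a prime is linear.\<close>

theorem integrally_closed_iff:
  assumes linear: "\<And>p I. prime p \<Longrightarrow> prime_ideal_set I \<Longrightarrow> of_int p \<in> I \<Longrightarrow> F \<in> I \<Longrightarrow> pderiv F \<in> I \<Longrightarrow>
    \<exists>r. [:- r, 1:] \<in> I"
  shows "integrally_closed_ring A \<longleftrightarrow>
    (\<forall>p r. prime p \<longrightarrow> \<not> (p ^ 2 dvd poly F r \<and> p dvd poly (pderiv F) r))"
proof
  assume "integrally_closed_ring A"
  thus "\<forall>p r. prime p \<longrightarrow> \<not> (p ^ 2 dvd poly F r \<and> p dvd poly (pderiv F) r)"
    using not_integrally_closed by blast
next
  assume good: "\<forall>p r. prime p \<longrightarrow> \<not> (p ^ 2 dvd poly F r \<and> p dvd poly (pderiv F) r)"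
  show "integrally_closed_ring A"
  proof (rule ccontr)
    assume "\<not> integrally_closed_ring A"
    then obtain p y where p: "prime p" and "p_defect p y" by (rule exists_p_defect)
    then obtain z where z: "p_defect p z" and I: "prime_ideal_set (conductor z)"
      and F': "pderiv F \<in> conductor z" using exists_prime_conductor by metis
    have pI: "of_int p \<in> conductor z" using p_defect_conductor[OF z, of 1] by (simp add: of_int_poly)
    obtain r where r: "[:- r, 1:] \<in> conductor z"
      using linear[OF p I pI root_in_conductor F'] by blast
    have val: "p dvd poly h r" if "h \<in> conductor z" for h
    proof -
      have "h - [:- r, 1:] * synthetic_div h r = of_int (poly h r)"
        using synthetic_div_correct'[of r h] by (simp add: of_int_poly algebra_simps)
      hence "of_int (poly h r) \<in> conductor z"
        using conductor_diff[OF that conductor_mult_right[OF r]] by metis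
      thus ?thesis using of_int_in_prime_ideal_iff[OF I p pI] by blast
    qed
    have "p ^ 2 dvd poly F r" using linear_conductor[OF p z r val[OF root_in_conductor]] .
    thus False using good p val[OF F'] by blast
  qed
qed

end

section \<open>The trinomial\<close>

lemma poly_trinomial9: "poly (trinomial9 a b) r = r ^ 9 + a * r + b"
  by (simp add: trinomial9_def poly_monom)

lemma trinomial9_eq: "trinomial9 a b = [:0, 1:] ^ 9 + of_int a * [:0, 1:] + of_int b"
  by (simp add: trinomial9_def monom_altdef of_int_poly)

lemma pderiv_trinomial9: "pderiv (trinomial9 a b) = 9 * [:0, 1:] ^ 8 + of_int a"
proof -
  have "pderiv (trinomial9 a b) = monom 9 8 + [:a:]"
    unfolding trinomial9_def by (simp add: pderiv_add pderiv_monom monom_0 del: monom_altdef)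
  thus ?thesis by (simp add: monom_altdef of_int_poly numeral_poly)
qed

lemma poly_pderiv_trinomial9: "poly (pderiv (trinomial9 a b)) r = 9 * r ^ 8 + a"
  by (simp add: pderiv_trinomial9)

lemma degree_trinomial9: "degree (trinomial9 a b) = 9"
proof -
  have "degree (monom a 1 + monom b 0) < degree (monom (1::int) 9)"
    using degree_add_le[OF degree_monom_le[of a 1] order.trans[OF degree_monom_le[of b 0] zero_le_one]]
    by (simp add: degree_monom_eq)
  thus ?thesis by (simp only: trinomial9_def add.assoc degree_add_eq_left) (simp add: degree_monom_eq)
qed

lemma lead_coeff_trinomial9: "lead_coeff (trinomial9 a b) = 1"
  unfolding degree_trinomial9 by (simp add: trinomial9_def)

text \<open>The Frobenius map of characteristic 3 applied twice. The explicit multiple of 3 keeps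
  the identity in \<open>\<int>[x]\<close>, where an ideal containing 3 absorbs it.\<close>

lemma power9_add_mod_3:
  fixes x y :: "'a::comm_ring_1"
  obtains w where "(x + y) ^ 9 = x ^ 9 + y ^ 9 + 3 * w"
proof -
  have cube: "(s + t) ^ 3 = s ^ 3 + t ^ 3 + 3 * (s ^ 2 * t + s * t ^ 2)" for s t :: 'a
    by (simp add: power3_eq_cube power2_eq_square algebra_simps)
  define u where "u = x ^ 2 * y + x * y ^ 2"
  define v where "v = x ^ 3 + y ^ 3"
  have "(x + y) ^ 9 = ((x + y) ^ 3) ^ 3" by (simp flip: power_mult)
  also have "\<dots> = (v + 3 * u) ^ 3" by (simp add: cube[of x y] u_def v_def)
  also have "\<dots> = v ^ 3 + 3 * (9 * u ^ 3 + (v ^ 2 * (3 * u) + v * (3 * u) ^ 2))"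
    unfolding cube[of v] by (simp add: power_mult_distrib algebra_simps)
  also have "v ^ 3 = x ^ 9 + y ^ 9 + 3 * ((x ^ 3) ^ 2 * y ^ 3 + x ^ 3 * (y ^ 3) ^ 2)"
    unfolding v_def cube by (simp flip: power_mult)
  finally have "(x + y) ^ 9 = x ^ 9 + y ^ 9 + 3 * (((x ^ 3) ^ 2 * y ^ 3 + x ^ 3 * (y ^ 3) ^ 2)
      + (9 * u ^ 3 + (v ^ 2 * (3 * u) + v * (3 * u) ^ 2)))"
    by (simp only: add.assoc distrib_left)
  thus ?thesis by (rule that)
qed

lemma power8_add_1_mod_2:
  fixes x :: "'a::comm_ring_1"
  obtains w where "(x + 1) ^ 8 = x ^ 8 + 1 + 2 * w"
proof -
  \<comment> \<open>The error \<open>2 * v\<close> is carried along so that the same identity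
    applies to the result of the previous squaring.\<close>
  have square: "\<exists>w. (y + 1 + 2 * v) ^ 2 = y ^ 2 + 1 + 2 * w" for y v :: 'a
    by (rule exI[of _ "y + 2 * v ^ 2 + 2 * y * v + 2 * v"]) (simp add: power2_eq_square algebra_simps)
  obtain u where u: "(x + 1) ^ 2 = x ^ 2 + 1 + 2 * u" using square[of x 0] by auto
  obtain v where v: "((x + 1) ^ 2) ^ 2 = (x ^ 2) ^ 2 + 1 + 2 * v" using square[of "x ^ 2" u] unfolding u by blast
  obtain w where "(((x + 1) ^ 2) ^ 2) ^ 2 = ((x ^ 2) ^ 2) ^ 2 + 1 + 2 * w"
    using square[of "(x ^ 2) ^ 2" v] unfolding v by blast
  thus ?thesis using that by (simp flip: power_mult)
qed

lemma int_power9_mod_3: "3 dvd b ^ 9 - (b::int)"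
proof -
  have "b mod 3 = 0 \<or> b mod 3 = 1 \<or> b mod 3 = 2" by presburger
  hence "((b mod 3) ^ 9 - b mod 3) mod 3 = 0"
    by (elim disjE; simp only:; simp)
  moreover have "(b ^ 9 - b) mod 3 = ((b mod 3) ^ 9 - b mod 3) mod 3"
    by (intro mod_diff_cong) (simp_all add: power_mod)
  ultimately show ?thesis by (simp only: dvd_eq_mod_eq_0)
qed

lemma prime_int_dvd_prime_power:
  fixes p q :: int
  assumes "prime p" "prime q" "p dvd q ^ n"
  shows "p = q"
  using assms by (meson prime_dvd_power primes_dvd_imp_eq)

text \<open>Modulo \<open>p\<close>, \<open>F\<close> is \<open>x ^ 9\<close> if \<open>p\<close>
  divides both coefficients. If it divides only \<open>a\<close>, the derivative forces
  \<open>p = 3\<close> and \<open>F\<close> is \<open>(x + b) ^ 9\<close>; if only \<open>b\<close>,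
  it forces \<open>p = 2\<close> and \<open>F\<close> is \<open>x (x + 1) ^ 8\<close>. Otherwise
  \<open>9 F - x F' = 8 a x + 9 b\<close> is linear with invertible leading coefficient.\<close>

lemma trinomial9_ramified_prime_linear:
  fixes p :: int
  assumes I: "prime_ideal_set I" and p: "prime p" "of_int p \<in> I"
    and F: "trinomial9 a b \<in> I" and F': "pderiv (trinomial9 a b) \<in> I"
  obtains r where "[:- r, 1:] \<in> I"
proof -
  define X :: "int poly" where "X = [:0, 1:]"
  note cI = of_int_in_prime_ideal_iff[OF I p]
  note DI = prime_ideal_setD[OF I]
  have F: "X ^ 9 + of_int a * X + of_int b \<in> I" using F by (simp only: trinomial9_eq X_def)
  have F': "9 * X ^ 8 + of_int a \<in> I" using F' by (simp only: pderiv_trinomial9 X_def)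
  have lin: "X + of_int c = [:c, 1:]" for c by (simp add: X_def of_int_poly)
  have X9: "X ^ 9 = X * X ^ 8" by (simp add: numeral_eq_Suc)
  consider "p dvd a" "p dvd b" | "p dvd a" "\<not> p dvd b" | "\<not> p dvd a" "p dvd b" | "\<not> p dvd a" "\<not> p dvd b"
    by blast
  thus ?thesis
  proof cases
    case 1
    hence "of_int a * X \<in> I" "of_int b \<in> I" using cI DI(5) by auto
    hence "(X ^ 9 + of_int a * X + of_int b) - (of_int a * X + of_int b) \<in> I" using F DI(2,3) by blast
    hence "X ^ 9 \<in> I" by simp
    hence "X \<in> I" by (rule DI(7))
    thus ?thesis using that[of 0] by (simp add: X_def)
  next
    case 2
    hence a: "of_int a \<in> I" "of_int b \<notin> I" using cI by auto
    have "(9 * X ^ 8 + of_int a) - of_int a \<in> I" using F' a DI(3) by blast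
    hence "9 * X ^ 8 \<in> I" by simp
    hence "9 \<in> I \<or> X \<in> I" using DI(6,7) by blast
    moreover have "X \<notin> I"
    proof
      assume "X \<in> I"
      hence "X ^ 8 * X + of_int a * X \<in> I" using DI(2,4) by blast
      hence "(X ^ 9 + of_int a * X + of_int b) - (X ^ 8 * X + of_int a * X) \<in> I" using F DI(3) by blast
      thus False using a by (simp add: X9 mult.commute)
    qed
    ultimately have "p dvd 3 ^ 2" using cI[of 9] by simp
    hence p3: "p = 3" using p(1) prime_int_dvd_prime_power[of p 3 2] by simp
    have three: "3 * w \<in> I" for w using DI(5)[OF p(2), of w] by (simp add: p3)
    obtain w where w: "(X + of_int b) ^ 9 = X ^ 9 + of_int b ^ 9 + 3 * w" by (rule power9_add_mod_3)
    have "of_int (b ^ 9 - b) \<in> I" using cI int_power9_mod_3 p3 by blast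
    moreover have "of_int (b ^ 9 - b) = of_int b ^ 9 - of_int b" by simp
    ultimately have "(of_int b ^ 9 - of_int b) + ((X ^ 9 + of_int a * X + of_int b) - of_int a * X) + 3 * w \<in> I"
      using F a(1) three DI(2,3,5) by metis
    hence "(X + of_int b) ^ 9 \<in> I" unfolding w by (simp add: algebra_simps)
    hence "X + of_int b \<in> I" by (rule DI(7))
    thus ?thesis using that[of "- b"] by (simp add: lin)
  next
    case 3
    hence a: "of_int a \<notin> I" "of_int b \<in> I" using cI by auto
    have "(X ^ 9 + of_int a * X + of_int b) - of_int b \<in> I" using F a DI(3) by blast
    hence "X * (X ^ 8 + of_int a) \<in> I" by (simp add: X9 algebra_simps)
    moreover have "X \<notin> I"
    proof
      assume "X \<in> I"
      hence "(9 * X ^ 7) * X \<in> I" using DI(4) by blast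
      hence "(9 * X ^ 8 + of_int a) - (9 * X ^ 7) * X \<in> I" using F' DI(3) by blast
      moreover have "(9 * X ^ 7) * X = 9 * X ^ 8" by (simp add: numeral_eq_Suc mult_ac)
      ultimately show False using a by simp
    qed
    ultimately have Xa: "X ^ 8 + of_int a \<in> I" using DI(6) by blast
    hence "(9 * X ^ 8 + of_int a) - (X ^ 8 + of_int a) \<in> I" using F' DI(3) by blast
    moreover have "(9 * X ^ 8 + of_int a) - (X ^ 8 + of_int a) = 8 * X ^ 8"
      by simp
    ultimately have "8 \<in> I" using \<open>X \<notin> I\<close> DI(6,7) by metis
    hence "p dvd 2 ^ 3" using cI[of 8] by simp
    hence p2: "p = 2" using p(1) prime_int_dvd_prime_power[of p 2 3] by simp
    have two: "2 * w \<in> I" for w using DI(5)[OF p(2), of w] by (simp add: p2)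
    obtain w where w: "(X + 1) ^ 8 = X ^ 8 + 1 + 2 * w" by (rule power8_add_1_mod_2)
    have "2 dvd a - 1" using 3(1) p2 by simp
    hence "of_int (a - 1) \<in> I" using cI p2 by blast
    hence "(X ^ 8 + of_int a) - of_int (a - 1) + 2 * w \<in> I" using Xa two DI(2,3) by blast
    moreover have "(X ^ 8 + of_int a) - of_int (a - 1) + 2 * w = (X + 1) ^ 8"
      by (simp add: w)
    ultimately have "X + 1 \<in> I" using DI(7) by metis
    thus ?thesis using that[of "-1"] using lin[of 1] by simp
  next
    case 4
    have "9 * (X ^ 9 + of_int a * X + of_int b) - X * (9 * X ^ 8 + of_int a) \<in> I"
      using F F' DI(3,4) by blast
    also have "9 * (X ^ 9 + of_int a * X + of_int b) - X * (9 * X ^ 8 + of_int a)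
        = of_int (8 * a) * X + of_int (9 * b)"
      by (simp add: X9 algebra_simps)
    finally have l: "of_int (8 * a) * X + of_int (9 * b) \<in> I" .
    \<comment> \<open>Otherwise \<open>p\<close> would divide \<open>9 * b\<close> as well, and
      being prime to \<open>a\<close> and \<open>b\<close> it would divide both 8 and 9.\<close>
    have "\<not> p dvd 8 * a"
    proof
      assume d: "p dvd 8 * a"
      hence "of_int (8 * a) * X \<in> I" using cI DI(5) by blast
      hence "of_int (9 * b) \<in> I" using DI(3)[OF l, of "of_int (8 * a) * X"] by simp
      hence "p dvd 9 * b" using cI by blast
      hence "p dvd 3 ^ 2" using prime_dvd_multD[OF p(1)] 4 by auto
      hence "p = 3" by (rule prime_int_dvd_prime_power[OF p(1), rotated]) simp
      moreover have "p dvd 2 ^ 3" using prime_dvd_multD[OF p(1) d] 4 by auto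
      hence "p = 2" by (rule prime_int_dvd_prime_power[OF p(1), rotated]) simp
      ultimately show False by simp
    qed
    hence "coprime p (8 * a)" using p(1) prime_imp_coprime by blast
    then obtain u v where uv: "u * p + v * (8 * a) = 1"
      using bezout_int[of p "8 * a"] by (metis coprime_iff_gcd_eq_1)
    have "of_int v * (of_int (8 * a) * X + of_int (9 * b)) + (of_int u * X) * of_int p \<in> I" using l p(2) DI(2,4) by blast
    also have "of_int v * (of_int (8 * a) * X + of_int (9 * b)) + (of_int u * X) * of_int p
        = of_int (u * p + v * (8 * a)) * X + of_int (v * (9 * b))"
      by (simp add: algebra_simps)
    also have "\<dots> = [:- (- (v * (9 * b))), 1:]" unfolding uv lin[symmetric] by simp
    finally show ?thesis by (rule that)
  qed
qed

section \<open>Valuations, the discriminant and singular points\<close>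

lemma padic_val_of_int_eq_0_iff:
  assumes "prime p"
  shows "padic_val p (of_int n) = 0 \<longleftrightarrow> \<not> p dvd n"
proof (cases "n = 0")
  case False
  have "\<not> is_unit p" using assms by auto
  thus ?thesis
    using False by (simp add: padic_val_of_int multiplicity_eq_zero_iff)
qed (simp add: padic_val_0)

text \<open>Zero fits in: its valuation is infinite, and \<open>p ^ 2\<close> divides it.\<close>

lemma padic_val_of_int_eq_1_iff:
  assumes "prime p"
  shows "padic_val p (of_int n) = 1 \<longleftrightarrow> p dvd n \<and> \<not> p ^ 2 dvd n"
proof (cases "n = 0")
  case False
  have "\<not> is_unit p" using assms by auto
  have "padic_val p (of_int n) = 1 \<longleftrightarrow> multiplicity p n = 1"
    using False by (simp add: padic_val_of_int one_ereal_def)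
  also have "\<dots> \<longleftrightarrow> 1 \<le> multiplicity p n \<and> \<not> 2 \<le> multiplicity p n" by auto
  also have "\<dots> \<longleftrightarrow> p ^ 1 dvd n \<and> \<not> p ^ 2 dvd n"
    by (simp only: power_dvd_iff_le_multiplicity[OF False \<open>\<not> is_unit p\<close>])
  finally show ?thesis by simp
qed (simp add: padic_val_0)

text \<open>For \<open>a \<noteq> 0\<close> this is \<open>(8 * a) ^ 8\<close> times the value of
  \<open>F'\<close> at \<open>- 9 b / (8 a)\<close>, the zero of \<open>9 F - x F'\<close>.\<close>

lemma disc9_eq: "disc9 a b = (8 * a) ^ 8 * a + 9 * (9 * b) ^ 8"
  by (simp add: disc9_def power_mult_distrib numeral_eq_Suc)

lemma power_diff_square_taylor:
  fixes x e :: "'a::comm_ring_1"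
  shows "\<exists>w. (x - e) ^ Suc n = x ^ Suc n - of_nat (Suc n) * x ^ n * e + e ^ 2 * w"
proof (induction n)
  case 0
  show ?case by (rule exI[of _ 0]) simp
next
  case (Suc n)
  then obtain w where "(x - e) ^ Suc n = x ^ Suc n - of_nat (Suc n) * x ^ n * e + e ^ 2 * w" by blast
  hence "(x - e) ^ Suc (Suc n) = (x - e) * (x ^ Suc n - of_nat (Suc n) * x ^ n * e + e ^ 2 * w)"
    by simp
  also have "\<dots> = x ^ Suc (Suc n) - of_nat (Suc (Suc n)) * x ^ Suc n * e
      + e ^ 2 * (x * w - e * w + of_nat (Suc n) * x ^ n)"
    by (simp add: algebra_simps power2_eq_square)
  finally show ?case by blast
qed

text \<open>By Taylor expansion, \<open>(9b)\<^sup>8 \<equiv> (8ar)\<^sup>8 - 8(8ar)\<^sup>7 E\<close> modulo \<open>E\<^sup>2\<close>, where \<open>E = 8ar + 9b = 9F(r) - rF'(r)\<close>.\<close>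

lemma square_dvd_disc9:
  fixes a b p r :: int
  assumes F: "p ^ 2 dvd r ^ 9 + a * r + b" and F': "p dvd 9 * r ^ 8 + a"
  shows "p ^ 2 dvd disc9 a b"
proof -
  define f where "f = r ^ 9 + a * r + b"
  define f' where "f' = 9 * r ^ 8 + a"
  define E where "E = 8 * a * r + 9 * b"
  obtain W where W: "(8 * a * r - E) ^ 8 = (8 * a * r) ^ 8 - 8 * (8 * a * r) ^ 7 * E + E ^ 2 * W"
    using power_diff_square_taylor[of "8 * a * r" E 7] by auto
  have r9: "r ^ 9 = r * r ^ 8" by (simp add: numeral_eq_Suc)
  have E: "E = 9 * f - r * f'" by (simp add: E_def f_def f'_def r9 algebra_simps)
  have b: "(9 * b) ^ 8 = (8 * a * r - E) ^ 8"
  proof -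
    have "8 * a * r - E = - (9 * b)" by (simp add: E_def)
    thus ?thesis by simp
  qed
  have "disc9 a b = (8 * a) ^ 8 * a + 9 * ((8 * a * r) ^ 8 - 8 * (8 * a * r) ^ 7 * E) + 9 * W * E ^ 2"
    unfolding disc9_eq b W by (simp add: algebra_simps)
  \<comment> \<open>Inserting \<open>E = 9 f - r f'\<close>, the terms in \<open>f'\<close> collect
    to \<open>8 (8 a)^7 f' (a + 9 r^8)\<close>, whose last factor is again \<open>f'\<close>. The
    square matters because only \<open>p dvd f'\<close> is available.\<close>
  also have "\<dots> = 8 * (8 * a) ^ 7 * f' ^ 2 - 648 * (8 * a * r) ^ 7 * f + 9 * W * E ^ 2"
  proof -
    define X where "X = (8 * a) ^ 7"
    define R where "R = r ^ 7"
    have pw: "(8 * a) ^ 8 = 8 * a * X" "(8 * a) ^ 7 = X" "(8 * a * r) ^ 7 = X * R" "(8 * a * r) ^ 8 = 8 * a * X * (r * R)"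
      by (simp_all add: X_def R_def power_mult_distrib numeral_eq_Suc)
    have f': "f' = 9 * (r * R) + a" by (simp add: f'_def R_def numeral_eq_Suc)
    show ?thesis unfolding E pw f' by (simp add: power2_eq_square algebra_simps)
  qed
  finally have eq: "disc9 a b = 8 * (8 * a) ^ 7 * f' ^ 2 - 648 * (8 * a * r) ^ 7 * f + 9 * W * E ^ 2" .
  have pf: "p ^ 2 dvd f" and pf': "p dvd f'" using F F' by (simp_all add: f_def f'_def)
  have "p dvd f" using pf by (metis dvd_mult_left power2_eq_square)
  hence "p dvd E" using pf' by (simp add: E)
  hence "p ^ 2 dvd E ^ 2" "p ^ 2 dvd f' ^ 2" using pf' by (simp_all add: dvd_power_same)
  thus ?thesis unfolding eq using pf by (intro dvd_add dvd_diff dvd_mult)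
qed

text \<open>Multiplied by \<open>(8 * a) ^ 8\<close> and \<open>(8 * a) ^ 9\<close>, the values
  \<open>F'(r)\<close> and \<open>F(r)\<close> involve \<open>r\<close> only through
  \<open>8 * a * r\<close>, which is \<open>- 9 * b\<close> modulo \<open>p ^ 2\<close>; they become
  \<open>disc9 a b\<close> and \<open>- b * disc9 a b\<close>.\<close>

lemma trinomial9_at_singular_point:
  fixes a b p r :: int
  assumes r: "p ^ 2 dvd 8 * a * r + 9 * b" and d: "p ^ 2 dvd disc9 a b" and p: "coprime p (8 * a)"
  shows "p ^ 2 dvd r ^ 9 + a * r + b" "p ^ 2 dvd 9 * r ^ 8 + a"
proof -
  define k where "k = 8 * a * r + 9 * b"
  have cop: "coprime (p ^ 2) ((8 * a) ^ n)" for n using p by simp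
  have ar: "8 * a * r = k - 9 * b" by (simp add: k_def)
  have pk: "k dvd (k - 9 * b) ^ n - (- (9 * b)) ^ n" for n
  proof -
    have "[k - 9 * b = - (9 * b)] (mod k)" by (simp add: cong_iff_dvd_diff)
    thus ?thesis using cong_pow cong_iff_dvd_diff by blast
  qed
  have diff: "p ^ 2 dvd (k - 9 * b) ^ n - (- (9 * b)) ^ n" for n
    using r pk[of n] unfolding k_def[symmetric] by (rule dvd_trans)
  define Z where "Z = (8 * a) ^ 8"
  define B where "B = (9 * b) ^ 8"
  have pw: "(8 * a) ^ 9 = 8 * a * Z" "(- (9 * b)) ^ 8 = B" "(- (9 * b)) ^ 9 = - (9 * b * B)"
    by (simp_all add: Z_def B_def numeral_eq_Suc)
  have disc: "disc9 a b = Z * a + 9 * B" by (simp add: disc9_eq Z_def B_def)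
  have "Z * (9 * r ^ 8 + a) = 9 * (8 * a * r) ^ 8 + Z * a"
    by (simp add: Z_def power_mult_distrib algebra_simps)
  also have "\<dots> = 9 * ((k - 9 * b) ^ 8 - (- (9 * b)) ^ 8) + disc9 a b"
    unfolding ar disc pw by (simp add: right_diff_distrib)
  finally have "p ^ 2 dvd Z * (9 * r ^ 8 + a)"
    using diff[of 8] d by (simp only: dvd_add dvd_mult)
  thus "p ^ 2 dvd 9 * r ^ 8 + a" unfolding Z_def using cop coprime_dvd_mult_right_iff by blast
  have "(8 * a) ^ 9 * (r ^ 9 + a * r + b) = (8 * a * r) ^ 9 + Z * a * (8 * a * r) + (8 * a) ^ 9 * b"
    unfolding power_mult_distrib[of "8 * a" r] distrib_left pw by simp
  also have "\<dots> = ((k - 9 * b) ^ 9 - (- (9 * b)) ^ 9) + Z * a * k - b * disc9 a b"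
    unfolding ar pw disc by (simp add: right_diff_distrib distrib_left)
  finally have "p ^ 2 dvd (8 * a) ^ 9 * (r ^ 9 + a * r + b)"
    using diff[of 9] d r unfolding k_def[symmetric] by (simp only: dvd_add dvd_diff dvd_mult)
  thus "p ^ 2 dvd r ^ 9 + a * r + b" using cop coprime_dvd_mult_right_iff by blast
qed

section \<open>The conditions modulo 9 and 4, and their relation to singular points\<close>

lemma mod_9_cases:
  fixes b :: int
  shows "b mod 9 \<in> {0, 1, 2, 3, 4, 5, 6, 7, 8}"
proof -
  have "0 \<le> b mod 9" "b mod 9 < 9" by simp_all
  thus ?thesis by auto
qed

text \<open>For \<open>3 dvd a\<close> the only candidate for a singular point modulo 3 is \<open>- b\<close>.\<close>

lemma cond_at_3_iff:
  assumes "3 dvd a" "\<not> 3 dvd b"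
  shows "cond_at_3 a b \<longleftrightarrow> \<not> 9 dvd b - b ^ 9 - a * b"
proof -
  define s where "s = a mod 9"
  define t where "t = b mod 9"
  have s: "s \<in> {0, 3, 6}"
    using assms(1) mod_9_cases[of a] unfolding s_def by (auto; presburger)
  have t: "t \<in> {1, 2, 4, 5, 7, 8}"
    using assms(2) mod_9_cases[of b] unfolding t_def by (auto; presburger)
  have "(b - b ^ 9 - a * b) mod 9 = (t - t ^ 9 - s * t) mod 9"
    unfolding s_def t_def by (intro mod_diff_cong mod_mult_cong) (simp_all add: power_mod)
  hence R: "9 dvd b - b ^ 9 - a * b \<longleftrightarrow> (t - t ^ 9 - s * t) mod 9 = 0"
    by (simp only: dvd_eq_mod_eq_0)
  have L: "cond_at_3 a b \<longleftrightarrow> (\<exists>(u, v) \<in> {(0, 2), (0, 5), (3, -1), (3, 2), (6, -1), (6, 5),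
                     (0, 4), (0, 7), (3, 1), (3, 7), (6, 1), (6, 4)}. s = u mod 9 \<and> t = v mod 9)"
    using assms by (simp add: cond_at_3_def cong_def s_def t_def)
  show ?thesis unfolding R L using s t
    by (simp only: insert_iff empty_iff, elim disjE FalseE; simp only:; simp)
qed

text \<open>Here \<open>b - a - 1\<close> is \<open>F(- 1)\<close>, and -1 represents the repeated
  root of \<open>x (x + 1) ^ 8\<close> modulo 2.\<close>

lemma cond_at_2_iff:
  assumes "\<not> 2 dvd a" "2 dvd b"
  shows "cond_at_2 a b \<longleftrightarrow> \<not> 4 dvd b - a - 1"
  unfolding cond_at_2_def cong_def using assms by (simp, presburger)

lemma no_singular_point_imp_conditions:
  assumes good: "\<And>p r. prime p \<Longrightarrow> \<not> (p ^ 2 dvd r ^ 9 + a * r + b \<and> p dvd 9 * r ^ 8 + a)"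
  shows "cond_common_primes a b \<and> cond_at_2 a b \<and> cond_at_3 a b \<and> cond_disc a b"
proof (intro conjI)
  show "cond_common_primes a b"
    unfolding cond_common_primes_def
  proof (intro allI impI)
    fix p assume p: "prime p \<and> p dvd a \<and> p dvd b"
    hence "\<not> p ^ 2 dvd b" using good[of p 0] by simp
    thus "padic_val p (of_int b) = 1" using p by (simp add: padic_val_of_int_eq_1_iff)
  qed
  show "cond_at_2 a b"
  proof (cases "\<not> 2 dvd a \<and> 2 dvd b")
    case True
    have "2 dvd 9 * (- 1) ^ 8 + a" using True by simp
    hence "\<not> 2 ^ 2 dvd (- 1) ^ 9 + a * (- 1) + b" using good[of 2 "-1"] by simp
    hence "\<not> 4 dvd b - a - 1" by (simp add: algebra_simps)
    thus ?thesis using True cond_at_2_iff by blast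
  qed (auto simp: cond_at_2_def)
  show "cond_at_3 a b"
  proof (cases "3 dvd a \<and> \<not> 3 dvd b")
    case True
    have "3 dvd 9 * (- b) ^ 8 + a" using True by (intro dvd_add) auto
    hence "\<not> 3 ^ 2 dvd (- b) ^ 9 + a * (- b) + b" using good[of 3 "- b"] by force
    moreover have "(- b) ^ 9 + a * (- b) + b = b - b ^ 9 - a * b" by simp
    ultimately have "\<not> 3 ^ 2 dvd b - b ^ 9 - a * b" by (simp only: not_False_eq_True)
    hence "\<not> 9 dvd b - b ^ 9 - a * b" by simp
    thus ?thesis using True cond_at_3_iff by blast
  qed (auto simp: cond_at_3_def)
  show "cond_disc a b"
    unfolding cond_disc_def
  proof (intro allI impI)
    fix p assume p: "prime p \<and> p \<notin> {2, 3} \<and> p dvd disc9 a b"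
      and ab: "padic_val p (of_int (a * b)) = 0"
    hence pr: "prime p" by simp
    have "\<not> p dvd a * b" using ab padic_val_of_int_eq_0_iff[OF pr] by blast
    hence "\<not> p dvd a" by auto
    moreover have "\<not> p dvd 2 ^ 3" using p prime_int_dvd_prime_power[OF pr, of 2 3] by auto
    ultimately have "\<not> p dvd 8 * a" using prime_dvd_multD[OF pr, of 8 a] by auto
    hence cop: "coprime p (8 * a)" using pr prime_imp_coprime by blast
    hence "coprime (8 * a) (p ^ 2)" by (simp add: coprime_commute)
    \<comment> \<open>The inverse of \<open>8 * a\<close> is taken modulo \<open>p ^ 2\<close>, not
      just \<open>p\<close>, because \<open>8 a r + 9 b\<close> must vanish to second order at the
      singular point \<open>r = - 9 b u\<close>.\<close>
    then obtain u where u: "[8 * a * u = 1] (mod p ^ 2)" using cong_solve_coprime_int by blast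
    have "[8 * a * u * (- (9 * b)) = 1 * (- (9 * b))] (mod p ^ 2)" using u by (rule cong_scalar_right)
    hence "p ^ 2 dvd 8 * a * u * (- (9 * b)) - 1 * (- (9 * b))" by (simp only: cong_iff_dvd_diff)
    hence r: "p ^ 2 dvd 8 * a * (u * (- (9 * b))) + 9 * b" by (simp add: mult.assoc)
    have "\<not> p ^ 2 dvd disc9 a b"
    proof
      assume d: "p ^ 2 dvd disc9 a b"
      note sing = trinomial9_at_singular_point[OF r d cop]
      have "p dvd 9 * (u * (- (9 * b))) ^ 8 + a" using sing(2) by (metis dvd_mult_left power2_eq_square)
      thus False using good[OF pr] sing(1) by blast
    qed
    thus "padic_val p (of_int (disc9 a b)) = 1" using p padic_val_of_int_eq_1_iff[OF pr] by blast
  qed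
qed

text \<open>As \<open>p\<close> divides \<open>F'(r)\<close>, the value \<open>F(r)\<close> modulo
  \<open>p ^ 2\<close> depends only on \<open>r\<close> modulo \<open>p\<close>. When
  \<open>p\<close> divides \<open>a\<close> or \<open>b\<close>, it is compared with the value at 0,
  \<open>- b\<close> or -1 that the conditions control; otherwise \<open>square_dvd_disc9\<close>
  contradicts \<open>cond_disc\<close>.\<close>

lemma conditions_imp_no_singular_point:
  fixes a b p r :: int
  assumes conds: "cond_common_primes a b" "cond_at_2 a b" "cond_at_3 a b" "cond_disc a b"
    and p: "prime p" and F: "p ^ 2 dvd r ^ 9 + a * r + b" and F': "p dvd 9 * r ^ 8 + a"
  shows False
proof -
  have pF: "p dvd r ^ 9 + a * r + b" using F by (metis dvd_mult_left power2_eq_square)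
  have r9: "r ^ 9 = r * r ^ 8" by (simp add: numeral_eq_Suc)
  consider "p dvd a" "p dvd b" | "p dvd a" "\<not> p dvd b" | "\<not> p dvd a" "p dvd b" | "\<not> p dvd a" "\<not> p dvd b"
    by blast
  thus False
  proof cases
    case 1
    have "p dvd a * r + b" using 1 by simp
    hence "p dvd r ^ 9" using pF by (metis add.assoc dvd_add_left_iff)
    hence "p dvd r" using p prime_dvd_power by blast
    hence "p ^ 2 dvd r ^ 2" "p * p dvd a * r" using 1 by (auto intro: mult_dvd_mono dvd_power_same)
    hence "p ^ 2 dvd r ^ 9 + a * r"
      by (metis dvd_add dvd_trans le_imp_power_dvd numeral_le_iff power2_eq_square semiring_norm(68) semiring_norm(69) semiring_norm(72))
    hence "p ^ 2 dvd b" using F by (metis dvd_add_right_iff)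
    thus False using conds(1) 1 p padic_val_of_int_eq_1_iff unfolding cond_common_primes_def by blast
  next
    case 2
    have "p dvd 9 * r ^ 8" using F' 2 by (metis dvd_add_left_iff)
    moreover have "\<not> p dvd r"
    proof
      assume "p dvd r"
      hence "p dvd r ^ 9 + a * r" by (simp add: r9)
      thus False using pF 2 by (metis dvd_add_right_iff)
    qed
    ultimately have "p dvd 3 ^ 2" using p prime_dvd_multD[OF p, of 9 "r ^ 8"] prime_dvd_power[OF p, of r 8] by auto
    hence p3: "p = 3" by (rule prime_int_dvd_prime_power[OF p, rotated]) simp
    have "3 dvd r ^ 9 - r" by (rule int_power9_mod_3)
    hence "3 dvd (r ^ 9 + a * r + b) - (r ^ 9 - r)" using pF p3 dvd_diff by blast
    moreover have "3 dvd a * r" using 2 p3 by simp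
    ultimately have "3 dvd (r ^ 9 + a * r + b) - (r ^ 9 - r) - a * r" by (rule dvd_diff)
    hence "3 dvd r + b" by (simp add: add.commute)
    then obtain k where k: "r = - b + 3 * k" by (auto elim!: dvdE simp: algebra_simps)
    \<comment> \<open>Cubing lifts the congruence of \<open>r\<close> and \<open>- b\<close> from
      modulus 3 to modulus 9.\<close>
    have "9 dvd r ^ 9 - (- b) ^ 9"
    proof -
      have "(- b + 3 * k) ^ 3 - (- b) ^ 3 = 9 * (b ^ 2 * k - 3 * b * k ^ 2 + 3 * k ^ 3)"
        by (simp add: power3_eq_cube power2_eq_square algebra_simps)
      hence "[r ^ 3 = (- b) ^ 3] (mod 9)" by (simp add: k cong_iff_dvd_diff)
      hence "[(r ^ 3) ^ 3 = ((- b) ^ 3) ^ 3] (mod 9)" by (rule cong_pow)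
      thus ?thesis by (simp add: cong_iff_dvd_diff flip: power_mult)
    qed
    moreover have "9 dvd a * (3 * k)" using 2 p3 by (auto elim!: dvdE)
    moreover have "9 dvd r ^ 9 + a * r + b" using F p3 by simp
    ultimately have "9 dvd (r ^ 9 + a * r + b) - (r ^ 9 - (- b) ^ 9) - a * (3 * k)"
      by (blast intro: dvd_diff)
    also have "(r ^ 9 + a * r + b) - (r ^ 9 - (- b) ^ 9) - a * (3 * k) = b - b ^ 9 - a * b"
      by (simp add: k algebra_simps)
    finally show False using cond_at_3_iff[of a b] conds(3) 2 p3 by blast
  next
    case 3
    have "p dvd r ^ 9 + a * r" using pF 3(2) by (metis dvd_add_left_iff)
    hence "p dvd r * (r ^ 8 + a)" by (simp add: r9 algebra_simps)
    moreover have nr: "\<not> p dvd r"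
    proof
      assume "p dvd r"
      hence "p dvd 9 * r ^ 8" by (intro dvd_mult dvd_trans[OF _ dvd_power[of 8 r]]) simp_all
      thus False using F' 3 by (metis dvd_add_right_iff)
    qed
    ultimately have "p dvd r ^ 8 + a" using prime_dvd_multD[OF p] by blast
    hence "p dvd (9 * r ^ 8 + a) - (r ^ 8 + a)" using F' dvd_diff by blast
    hence "p dvd 8 * r ^ 8" by simp
    hence "p dvd 2 ^ 3" using nr prime_dvd_multD[OF p, of 8 "r ^ 8"] prime_dvd_power[OF p, of r 8] by auto
    hence p2: "p = 2" by (rule prime_int_dvd_prime_power[OF p, rotated]) simp
    have "r mod 4 = 1 \<or> r mod 4 = 3" using nr p2 by presburger
    hence r4: "r ^ 9 mod 4 = r mod 4"
    proof -
      have "r ^ 9 mod 4 = (r mod 4) ^ 9 mod 4" by (simp add: power_mod)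
      also have "\<dots> = r mod 4" using \<open>_ \<or> _\<close> by (elim disjE; simp only:; simp)
      finally show ?thesis .
    qed
    have "4 dvd r ^ 9 - r" using r4 by (simp add: mod_eq_dvd_iff)
    moreover have "4 dvd r ^ 9 + a * r + b" using F p2 by simp
    ultimately have "4 dvd (r ^ 9 + a * r + b) - (r ^ 9 - r)" by (blast intro: dvd_diff)
    hence "4 dvd (a + 1) * r + b" by (simp add: algebra_simps)
    \<comment> \<open>Both factors are even, which allows \<open>r\<close> to be replaced by -1
      modulo 4.\<close>
    moreover have "4 dvd (a + 1) * (r + 1)"
      using nr 3 p2 mult_dvd_mono[of 2 "a + 1" 2 "r + 1"] by simp
    ultimately have "4 dvd ((a + 1) * r + b) - (a + 1) * (r + 1)" by (rule dvd_diff)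
    hence "4 dvd b - a - 1" by (simp add: algebra_simps)
    thus False using cond_at_2_iff[of a b] conds(2) 3 p2 by blast
  next
    case 4
    have "p dvd 9 * (r ^ 9 + a * r + b) - r * (9 * r ^ 8 + a)" using pF F' by (intro dvd_diff dvd_mult)
    also have "9 * (r ^ 9 + a * r + b) - r * (9 * r ^ 8 + a) = 8 * a * r + 9 * b"
      by (simp add: r9 algebra_simps)
    finally have E: "p dvd 8 * a * r + 9 * b" .
    have "p \<noteq> 2"
    proof
      assume p2: "p = 2"
      hence "2 dvd 8 * a * r + 9 * b" using E by simp
      thus False using 4 p2 by simp
    qed
    moreover have "p \<noteq> 3"
    proof
      assume p3: "p = 3"
      hence "3 dvd 9 * r ^ 8 + a" using F' by simp
      moreover have "3 dvd 9 * r ^ 8" by simp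
      ultimately have "3 dvd a" by (metis dvd_add_right_iff)
      thus False using 4 p3 by simp
    qed
    moreover have d: "p ^ 2 dvd disc9 a b" using F F' by (rule square_dvd_disc9)
    hence "p dvd disc9 a b" by (metis dvd_mult_left power2_eq_square)
    moreover have "\<not> p dvd a * b" using 4 prime_dvd_multD[OF p] by blast
    hence "padic_val p (of_int (a * b)) = 0" using padic_val_of_int_eq_0_iff[OF p] by blast
    ultimately have "padic_val p (of_int (disc9 a b)) = 1"
      using conds(4) p unfolding cond_disc_def by blast
    thus False using d padic_val_of_int_eq_1_iff[OF p] by blast
  qed
qed

theorem theorem2p1:
  fixes a b :: int and \<alpha> :: complex and K :: "complex set"
  assumes irr: "irreducible (map_poly rat_of_int (trinomial9 a b))"
    and val: "\<And>p :: int. prime p \<Longrightarrow>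
                padic_val p (of_int a) \<le> 7 \<or> padic_val p (of_int b) \<le> 8"
    and root: "poly (map_poly of_int (trinomial9 a b)) \<alpha> = 0"
    and K: "K = rat_adjoin \<alpha>"
  shows "(integrally_closed_ring (int_adjoin \<alpha>) \<longleftrightarrow>
            cond_common_primes a b \<and> cond_at_2 a b \<and> cond_at_3 a b \<and> cond_disc a b) \<and>
         (cond_common_primes a b \<and> cond_at_2 a b \<and> cond_at_3 a b \<and> cond_disc a b \<longrightarrow>
            monogenic_field K \<and> field_index K = 1)"
proof -
  interpret monic_integer_root "trinomial9 a b" \<alpha>
    using lead_coeff_trinomial9 irr root by unfold_locales
  have closed_iff: "integrally_closed_ring (int_adjoin \<alpha>) \<longleftrightarrow>
      (\<forall>p r. prime p \<longrightarrow> \<not> (p ^ 2 dvd r ^ 9 + a * r + b \<and> p dvd 9 * r ^ 8 + a))"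
    unfolding poly_trinomial9[symmetric] poly_pderiv_trinomial9[symmetric, of _ a b]
    by (rule integrally_closed_iff) (metis trinomial9_ramified_prime_linear)
  have main: "integrally_closed_ring (int_adjoin \<alpha>) \<longleftrightarrow>
      cond_common_primes a b \<and> cond_at_2 a b \<and> cond_at_3 a b \<and> cond_disc a b"
    unfolding closed_iff
    using no_singular_point_imp_conditions conditions_imp_no_singular_point by blast
  have "monogenic_field K \<and> field_index K = 1" if "integrally_closed_ring (int_adjoin \<alpha>)"
  proof -
    have "ring_of_integers (rat_adjoin \<alpha>) = int_adjoin \<alpha>"
      using ring_of_integers_eq_int_adjoin[OF monic degree_pos root that] .
    thus ?thesis
      using field_index_eq_1 self_in_int_adjoin unfolding K monogenic_field_def by blast
  qed
  thus ?thesis using main by blast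
qed

end
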